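(* Let $\alpha>0$ and consider the Hill's type lunar problem $$\ddot x-2\dot y=-V_x,\qquad \ddot y+2\dot x=-V_y,\qquad V(x,y)=-\frac{\alpha+2}{2}x^2-\frac{\alpha+2}{r^\alpha},\quad r=\sqrt{x^2+y^2}.$$ Let $$\mathcal W_+=\{\Gamma=(x,y,\dot x,\dot y): E(\Gamma)<E^*,\ W(\Gamma)>0\},\qquad \mathcal W_-=\{\Gamma=(x,y,\dot x,\dot y): E(\Gamma)<E^*,\ W(\Gamma)\le 0\}.$$ Then $\mathcal W_+$ and $\mathcal W_-$ are invariant. Solutions in $\mathcal W_+$ exist globally, and each solution in $\mathcal W_-$ either exists globally and is bounded (in configuration space), or collides with the origin in finite time. Moreover, if $\alpha\ge 2$, then all solutions in $\mathcal W_-$ collide with the origin in finite time.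
   Context: The phase space consists of $\Gamma=(x,y,\dot x,\dot y)\in\mathbb R^4$ with $(x,y)\ne(0,0)$. The energy $E(\Gamma)=\frac12(\dot x^2+\dot y^2)+V(x,y)$ is conserved. Put $W(\Gamma)=-xV_x-yV_y=(\alpha+2)\left(x^2-\frac{\alpha}{r^\alpha}\right)$. The ground state energy is $E^*=\inf\{E(\Gamma): W(\Gamma)=0\}=-\frac12(\alpha+2)^2\alpha^{-\alpha/(\alpha+2)}$, the energy of the equilibria $\pm Q=(\pm\alpha^{1/(\alpha+2)},0,0,0)$. For given initial data the solution is defined on a maximal forward interval $[0,T_{\max})$. It exists globally if $T_{\max}=\infty$. It collides with the origin in finite time if $T_{\max}<\infty$ and $(x(t),y(t))\to(0,0)$ as $t\to T_{\max}$. A set is invariant if a solution starting in it stays in it as long as the solution exists. *)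

theory Defs
  imports "HOL-Analysis.Analysis"
begin

type_synonym state = "real \<times> real \<times> real \<times> real"

definition phase_space :: "state set" where
  "phase_space = {(x, y, u, v). (x, y) \<noteq> (0, 0)}"

fun position :: "state \<Rightarrow> real \<times> real" where
  "position (x, y, u, v) = (x, y)"

definition V :: "real \<Rightarrow> real \<Rightarrow> real \<Rightarrow> real" where
  "V \<alpha> x y = - (\<alpha> + 2) / 2 * x\<^sup>2 - (\<alpha> + 2) / sqrt (x\<^sup>2 + y\<^sup>2) powr \<alpha>"

definition Vx :: "real \<Rightarrow> real \<Rightarrow> real \<Rightarrow> real" where
  "Vx \<alpha> x y = deriv (\<lambda>s. V \<alpha> s y) x"

definition Vy :: "real \<Rightarrow> real \<Rightarrow> real \<Rightarrow> real" where
  "Vy \<alpha> x y = deriv (\<lambda>s. V \<alpha> x s) y"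

fun E :: "real \<Rightarrow> state \<Rightarrow> real" where
  "E \<alpha> (x, y, u, v) = (u\<^sup>2 + v\<^sup>2) / 2 + V \<alpha> x y"

fun W :: "real \<Rightarrow> state \<Rightarrow> real" where
  "W \<alpha> (x, y, u, v) = - x * Vx \<alpha> x y - y * Vy \<alpha> x y"

definition E_star :: "real \<Rightarrow> real" where
  "E_star \<alpha> = Inf {E \<alpha> \<Gamma> |\<Gamma>. \<Gamma> \<in> phase_space \<and> W \<alpha> \<Gamma> = 0}"

definition W_plus :: "real \<Rightarrow> state set" where
  "W_plus \<alpha> = {\<Gamma> \<in> phase_space. E \<alpha> \<Gamma> < E_star \<alpha> \<and> W \<alpha> \<Gamma> > 0}"

definition W_minus :: "real \<Rightarrow> state set" where
  "W_minus \<alpha> = {\<Gamma> \<in> phase_space. E \<alpha> \<Gamma> < E_star \<alpha> \<and> W \<alpha> \<Gamma> \<le> 0}"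

(* The second-order system x'' - 2 y' = - V_x, y'' + 2 x' = - V_y as a vector field in
   (x, y, u, v) = (x, y, x', y'). *)
fun hill_field :: "real \<Rightarrow> state \<Rightarrow> state" where
  "hill_field \<alpha> (x, y, u, v) = (u, v, 2 * v - Vx \<alpha> x y, - 2 * u - Vy \<alpha> x y)"

(* Solution on the forward interval [0, T), where T = \<infinity> is allowed.  The values of \<gamma> outside
   [0, T) are irrelevant; restricting the derivative to {0..} only makes it one-sided at 0. *)
definition solution :: "real \<Rightarrow> ereal \<Rightarrow> (real \<Rightarrow> state) \<Rightarrow> bool" where
  "solution \<alpha> T \<gamma> \<longleftrightarrow> 0 < T \<and>
     (\<forall>t. 0 \<le> t \<and> ereal t < T \<longrightarrow>
        \<gamma> t \<in> phase_space \<and>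
        (\<gamma> has_vector_derivative hill_field \<alpha> (\<gamma> t)) (at t within {0..}))"

(* The solution admits no continuation beyond T, i.e. T is its T_max. *)
definition maximal_solution :: "real \<Rightarrow> ereal \<Rightarrow> (real \<Rightarrow> state) \<Rightarrow> bool" where
  "maximal_solution \<alpha> T \<gamma> \<longleftrightarrow> solution \<alpha> T \<gamma> \<and>
     \<not> (\<exists>T' \<gamma>'. T < T' \<and> solution \<alpha> T' \<gamma>' \<and>
          (\<forall>t. 0 \<le> t \<and> ereal t < T \<longrightarrow> \<gamma>' t = \<gamma> t))"

definition invariant :: "real \<Rightarrow> state set \<Rightarrow> bool" where
  "invariant \<alpha> A \<longleftrightarrow>
     (\<forall>T \<gamma>. solution \<alpha> T \<gamma> \<and> \<gamma> 0 \<in> A \<longrightarrow>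
        (\<forall>t. 0 \<le> t \<and> ereal t < T \<longrightarrow> \<gamma> t \<in> A))"

definition collides :: "ereal \<Rightarrow> (real \<Rightarrow> state) \<Rightarrow> bool" where
  "collides T \<gamma> \<longleftrightarrow> T < \<infinity> \<and>
     ((\<lambda>t. position (\<gamma> t)) \<longlongrightarrow> (0, 0)) (at_left (real_of_ereal T))"

lemma DERIV_V_x:
  assumes "(x, y) \<noteq> (0, 0)"
  shows "((\<lambda>s. V \<alpha> s y) has_real_derivative
     - (\<alpha> + 2) * x + \<alpha> * (\<alpha> + 2) * x / sqrt (x\<^sup>2 + y\<^sup>2) powr (\<alpha> + 2)) (at x)"
proof -
  have p: "x\<^sup>2 + y\<^sup>2 > 0" using assms by (simp add: sum_power2_gt_zero_iff)
  define r where "r = sqrt (x\<^sup>2 + y\<^sup>2)"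
  have r: "r > 0" using p by (simp add: r_def)
  have dr: "((\<lambda>s. sqrt (s\<^sup>2 + y\<^sup>2)) has_real_derivative x / r) (at x)"
    unfolding r_def using p by (auto intro!: derivative_eq_intros simp: field_simps)
  have *: "((\<lambda>s. sqrt (s\<^sup>2 + y\<^sup>2) powr (- \<alpha>)) has_real_derivative
      - \<alpha> * r powr (- \<alpha> - 1) * (x / r)) (at x)"
    using DERIV_fun_powr[OF dr, of "- \<alpha>"] r by (simp add: r_def)
  have e: "r powr (- \<alpha> - 1) / r = 1 / r powr (\<alpha> + 2)"
  proof -
    have "r powr (- \<alpha> - 1) / r = r powr (- \<alpha> - 1 - 1)"
      unfolding powr_diff [of r "- \<alpha> - 1" 1] using r by simp
    also have "- \<alpha> - 1 - 1 = - (\<alpha> + 2)" by simp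
    finally show ?thesis by (simp only: powr_minus_divide)
  qed
  have Vf: "(\<lambda>s. V \<alpha> s y) = (\<lambda>s. - (\<alpha> + 2) / 2 * s\<^sup>2 - (\<alpha> + 2) * sqrt (s\<^sup>2 + y\<^sup>2) powr (- \<alpha>))"
    by (simp add: V_def powr_minus_divide)
  have "((\<lambda>s. V \<alpha> s y) has_real_derivative
      - (\<alpha> + 2) * x - (\<alpha> + 2) * (- \<alpha> * r powr (- \<alpha> - 1) * (x / r))) (at x)"
    unfolding Vf
    by (intro DERIV_diff DERIV_cmult *) (auto intro!: derivative_eq_intros)
  moreover have "(\<alpha> + 2) * (- \<alpha> * r powr (- \<alpha> - 1) * (x / r)) =
      - (\<alpha> * (\<alpha> + 2) * x * (r powr (- \<alpha> - 1) / r))" by simp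
  ultimately show ?thesis unfolding e by (simp add: r_def)
qed

lemma DERIV_V_y:
  assumes "(x, y) \<noteq> (0, 0)"
  shows "((\<lambda>s. V \<alpha> x s) has_real_derivative
     \<alpha> * (\<alpha> + 2) * y / sqrt (x\<^sup>2 + y\<^sup>2) powr (\<alpha> + 2)) (at y)"
proof -
  have Vf: "(\<lambda>s. V \<alpha> x s) = (\<lambda>s. V \<alpha> s x + ((\<alpha> + 2) / 2 * s\<^sup>2 - (\<alpha> + 2) / 2 * x\<^sup>2))"
    by (simp add: V_def add.commute fun_eq_iff field_simps)
  have "((\<lambda>s. V \<alpha> s x) has_real_derivative
     - (\<alpha> + 2) * y + \<alpha> * (\<alpha> + 2) * y / sqrt (y\<^sup>2 + x\<^sup>2) powr (\<alpha> + 2)) (at y)"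
    using assms by (intro DERIV_V_x) auto
  note d = this
  show ?thesis unfolding Vf
    by (rule DERIV_cong [OF DERIV_add [OF d]])
       (auto intro!: derivative_eq_intros simp: add.commute algebra_simps)
qed

lemma W_eq:
  assumes "(x, y, u, v) \<in> phase_space"
  shows "W \<alpha> (x, y, u, v) = (\<alpha> + 2) * (x\<^sup>2 - \<alpha> / sqrt (x\<^sup>2 + y\<^sup>2) powr \<alpha>)"
proof -
  have n: "(x, y) \<noteq> (0, 0)" using assms by (simp add: phase_space_def)
  define r where "r = sqrt (x\<^sup>2 + y\<^sup>2)"
  have p: "x\<^sup>2 + y\<^sup>2 > 0" using n by (simp add: sum_power2_gt_zero_iff)
  have r: "r > 0" "x\<^sup>2 + y\<^sup>2 = r\<^sup>2" using p by (auto simp: r_def)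
  have "W \<alpha> (x, y, u, v) =
      (\<alpha> + 2) * x\<^sup>2 - \<alpha> * (\<alpha> + 2) * (x\<^sup>2 + y\<^sup>2) / r powr (\<alpha> + 2)"
    using DERIV_imp_deriv[OF DERIV_V_x[OF n]] DERIV_imp_deriv[OF DERIV_V_y[OF n]]
    by (simp add: Vx_def Vy_def flip: r_def)
       (simp add: power2_eq_square add_divide_distrib algebra_simps)
  also have "(x\<^sup>2 + y\<^sup>2) / r powr (\<alpha> + 2) = 1 / r powr \<alpha>"
    using r by (simp add: powr_add)
  then have "\<alpha> * (\<alpha> + 2) * (x\<^sup>2 + y\<^sup>2) / r powr (\<alpha> + 2) = \<alpha> * (\<alpha> + 2) / r powr \<alpha>"
    by (metis mult.right_neutral times_divide_eq_right)
  finally show ?thesis by (simp add: r_def algebra_simps)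
qed

lemma E_star_eq:
  assumes "\<alpha> > 0"
  shows "E_star \<alpha> = - 1 / 2 * (\<alpha> + 2)\<^sup>2 * \<alpha> powr (- \<alpha> / (\<alpha> + 2))" (is "_ = ?e")
    and "E_star \<alpha> = E \<alpha> (\<alpha> powr (1 / (\<alpha> + 2)), 0, 0, 0)"
proof -
  define q where "q = \<alpha> powr (1 / (\<alpha> + 2))"
  have q: "q > 0" using assms by (simp add: q_def)
  have qa: "q powr \<alpha> = \<alpha> powr (\<alpha> / (\<alpha> + 2))" by (simp add: q_def powr_powr)
  have q2: "q powr (\<alpha> + 2) = \<alpha>" using assms by (simp add: q_def powr_powr)
  have q2': "q\<^sup>2 = \<alpha> / q powr \<alpha>"
    using q2 q by (simp add: powr_add field_simps)
  have e: "?e = - (\<alpha> + 2)\<^sup>2 / (2 * q powr \<alpha>)"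
    unfolding qa by (simp add: powr_minus_divide)
  have Eq: "E \<alpha> (q, 0, 0, 0) = ?e"
  proof -
    have "E \<alpha> (q, 0, 0, 0) = - (\<alpha> + 2) / 2 * q\<^sup>2 - (\<alpha> + 2) / q powr \<alpha>"
      using q by (simp add: V_def)
    also have "\<dots> = ?e"
      unfolding e q2' using q by (simp add: field_simps power2_eq_square)
    finally show ?thesis .
  qed
  have Qin: "?e \<in> {E \<alpha> \<Gamma> |\<Gamma>. \<Gamma> \<in> phase_space \<and> W \<alpha> \<Gamma> = 0}"
  proof -
    have "(q, 0, 0, 0) \<in> phase_space" using q by (simp add: phase_space_def)
    moreover have "W \<alpha> (q, 0, 0, 0) = (\<alpha> + 2) * (q\<^sup>2 - \<alpha> / q powr \<alpha>)"
      using W_eq [OF calculation, of \<alpha>] q by (simp del: W.simps)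
    then have "W \<alpha> (q, 0, 0, 0) = 0" unfolding q2' by simp
    ultimately show ?thesis using Eq by (metis (mono_tags, lifting) mem_Collect_eq)
  qed
  have low: "?e \<le> E \<alpha> \<Gamma>" if "\<Gamma> \<in> phase_space" "W \<alpha> \<Gamma> = 0" for \<Gamma>
  proof -
    obtain x y u v where \<Gamma>: "\<Gamma> = (x, y, u, v)" by (cases \<Gamma>)
    define r where "r = sqrt (x\<^sup>2 + y\<^sup>2)"
    have n: "(x, y) \<noteq> (0, 0)" using that \<Gamma> by (simp add: phase_space_def)
    then have p: "x\<^sup>2 + y\<^sup>2 > 0" by (simp add: sum_power2_gt_zero_iff)
    then have r: "r > 0" "r\<^sup>2 = x\<^sup>2 + y\<^sup>2" by (auto simp: r_def)
    have w: "x\<^sup>2 = \<alpha> / r powr \<alpha>"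
      using that W_eq[of x y u v \<alpha>] assms unfolding \<Gamma> r_def by (simp del: W.simps)
    have "\<alpha> / r powr \<alpha> \<le> r\<^sup>2" using w r by simp
    then have "q powr (\<alpha> + 2) \<le> r powr (\<alpha> + 2)"
      unfolding q2 using r by (simp add: powr_add field_simps)
    then have "\<not> r powr (\<alpha> + 2) < q powr (\<alpha> + 2)" by simp
    then have "q \<le> r"
      using powr_less_mono2[of "\<alpha> + 2" r q] r(1) assms by (metis add_pos_pos
        less_eq_real_def linorder_not_less zero_less_numeral)
    then have le: "q powr \<alpha> \<le> r powr \<alpha>" using q assms by (intro powr_mono2) auto
    have "?e \<le> - (\<alpha> + 2)\<^sup>2 / (2 * r powr \<alpha>)"
      unfolding e using le q r by (simp add: divide_left_mono)
    also have "\<dots> = - (\<alpha> + 2) / 2 * x\<^sup>2 - (\<alpha> + 2) / r powr \<alpha>"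
      unfolding w using r(1) by (simp add: field_simps power2_eq_square)
    also have "\<dots> = V \<alpha> x y" by (simp add: V_def r_def)
    also have "\<dots> \<le> E \<alpha> \<Gamma>" by (simp add: \<Gamma>)
    finally show ?thesis .
  qed
  show "E_star \<alpha> = ?e"
    unfolding E_star_def using Qin low by (intro cInf_eq_minimum) auto
  then show "E_star \<alpha> = E \<alpha> (\<alpha> powr (1 / (\<alpha> + 2)), 0, 0, 0)"
    using Eq by (simp add: q_def)
qed

end

theory Submission
  imports Defs
begin

text \<open>
  Below the ground state energy \<open>W\<close> cannot vanish, so its sign is preserved along solutions. Write
  \<open>q = \<alpha> powr (1 / (\<alpha> + 2))\<close>. If \<open>W > 0\<close>, then \<open>r \<ge> q\<close>, the force grows at most linearly, and
  Gronwall's inequality excludes blow-up. If \<open>W \<le> 0\<close>, then the energy bound forces \<open>r < q\<close>, and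
  conservation of energy makes \<open>r powr (\<alpha> + 2)\<close> Lipschitz in time. Hence it converges as
  \<open>t \<rightarrow> T\<close> when \<open>T < \<infinity>\<close>; a positive limit would confine the solution to a compact subset of phase
  space, where it could be continued, so the limit is \<open>0\<close>. For \<open>\<alpha> \<ge> 2\<close> the virial identity
  gives \<open>(r\<^sup>2 / 2)'' \<le> 2 * (E - E\<^sup>*) < 0\<close>, which rules out global existence.
\<close>

subsection \<open>Local existence and limits at the end of an interval\<close>

text \<open>Picard iteration on bounded continuous functions with the field replaced by its values
  at closest points of the ball. The fixed point stays in the ball, where the modified field
  \<open>F\<close> is \<open>f\<close> itself. A forward solution suffices for continuation.\<close>

lemma picard_local:
  fixes f :: "'a::euclidean_space \<Rightarrow> 'a"
  assumes d: "0 < d" and L: "L-lipschitz_on (cball p d) f"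
  obtains \<epsilon> \<eta> where "0 < \<epsilon>" "\<eta> 0 = p"
    "\<And>t. t \<in> {0..\<epsilon>} \<Longrightarrow> \<eta> t \<in> cball p d \<and> (\<eta> has_vector_derivative f (\<eta> t)) (at t within {0..\<epsilon>})"
proof -
  \<comment> \<open>Projecting onto the ball makes the field globally Lipschitz, so Banach's theorem applies on a whole space.\<close>
  define F where "F = f \<circ> closest_point (cball p d)"
  have cp: "closest_point (cball p d) z \<in> cball p d" for z
    using d by (intro closest_point_in_set) auto
  have L0: "0 \<le> L" using L by (rule lipschitz_on_nonneg)
  have F_dist: "dist (F y) (F z) \<le> L * dist y z" for y z
  proof -
    have "dist (F y) (F z) \<le> L * dist (closest_point (cball p d) y) (closest_point (cball p d) z)"
      unfolding F_def o_def by (rule lipschitz_onD[OF L cp cp])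
    also have "\<dots> \<le> L * dist y z"
      using d L0 by (intro mult_left_mono closest_point_lipschitz) auto
    finally show ?thesis .
  qed
  then have "L-lipschitz_on UNIV F" using L0 by (intro lipschitz_onI) auto
  then have F_cont: "continuous_on UNIV F" by (rule lipschitz_on_continuous_on)
  define B where "B = norm (f p) + L * d"
  have B0: "0 \<le> B" using L0 d by (simp add: B_def)
  have F_bound: "norm (F z) \<le> B" for z
  proof -
    have "dist (F z) (f p) \<le> L * dist (closest_point (cball p d) z) p"
      unfolding F_def o_def using d by (intro lipschitz_onD[OF L cp]) auto
    also have "\<dots> \<le> L * d"
      using cp[of z] L0 by (intro mult_left_mono) (auto simp: dist_commute)
    finally show ?thesis unfolding B_def dist_norm using norm_triangle_sub[of "F z" "f p"] by linarith
  qed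
  \<comment> \<open>The first bound makes the Picard map a contraction with factor 1/2, the second
    keeps its values in the ball. Adding 1 in the denominators covers \<open>L = 0\<close> and
    \<open>B = 0\<close>.\<close>
  define \<epsilon> where "\<epsilon> = min (1 / (2 * (L + 1))) (d / (B + 1))"
  have \<epsilon>: "0 < \<epsilon>" using L0 B0 d by (simp add: \<epsilon>_def)
  have L\<epsilon>: "L * \<epsilon> \<le> 1 / 2"
  proof -
    have "L * \<epsilon> \<le> L * (1 / (2 * (L + 1)))" using L0 by (intro mult_left_mono) (auto simp: \<epsilon>_def)
    also have "\<dots> \<le> 1 / 2" using L0 by (simp add: field_simps)
    finally show ?thesis .
  qed
  have B\<epsilon>: "B * \<epsilon> \<le> d"
  proof -
    have "B * \<epsilon> \<le> B * (d / (B + 1))" using B0 by (intro mult_left_mono) (auto simp: \<epsilon>_def)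
    also have "\<dots> \<le> d" using B0 d by (simp add: field_simps)
    finally show ?thesis .
  qed
  \<comment> \<open>Clamping time to \<open>{0..\<epsilon>}\<close> turns the Picard integral into a
    bounded function on the whole real line, as the type of bounded continuous functions
    demands.\<close>
  define c where "c t = max 0 (min \<epsilon> t)" for t :: real
  have c: "c t \<in> {0..\<epsilon>}" for t using \<epsilon> by (auto simp: c_def)
  have c_cont: "continuous_on UNIV c" unfolding c_def by (intro continuous_intros)
  have Fg_cont: "continuous_on S (\<lambda>s. F (apply_bcontfun g s))" for g :: "real \<Rightarrow>\<^sub>C 'a" and S
    by (intro continuous_on_compose2[OF F_cont] continuous_intros) auto
  define P where "P g t = p + integral {0..c t} (\<lambda>s. F (apply_bcontfun g s))" for g :: "real \<Rightarrow>\<^sub>C 'a" and t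
  have P_bound: "norm (P g t - p) \<le> B * c t" for g t
    using integral_bound[of 0 "c t" "\<lambda>s. F (apply_bcontfun g s)" B] c[of t] F_bound Fg_cont
    by (auto simp: P_def)
  have P_in: "P g \<in> bcontfun" for g
  proof -
    have "continuous_on UNIV (\<lambda>t. integral {0..c t} (\<lambda>s. F (apply_bcontfun g s)))"
      using c by (intro continuous_on_compose2[OF _ c_cont, of "{0..\<epsilon>}"]
          indefinite_integral_continuous_1 integrable_continuous_real[OF Fg_cont]) auto
    then have "continuous_on UNIV (P g)" unfolding P_def by (intro continuous_intros)
    moreover have "P g t \<in> cball p (B * \<epsilon>)" for t
      using P_bound[of g t] mult_left_mono[of "c t" \<epsilon> B] c[of t] B0
      by (auto simp: dist_norm norm_minus_commute)
    then have "bounded (range (P g))"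
      by (intro bounded_subset[OF bounded_cball]) auto
    ultimately show ?thesis by (simp add: bcontfun_def)
  qed
  have "\<exists>!g. Bcontfun (P g) = g"
  proof (rule banach_fix_type[of "1/2"])
    show "\<forall>g h. dist (Bcontfun (P g)) (Bcontfun (P h)) \<le> 1 / 2 * dist g h"
    proof (intro allI dist_bound)
      fix g h :: "real \<Rightarrow>\<^sub>C 'a" and t
      have int: "(\<lambda>s. F (apply_bcontfun g' s)) integrable_on {0..c t}" for g'
        by (rule integrable_continuous_real[OF Fg_cont])
      have "dist (P g t) (P h t) = norm (integral {0..c t} (\<lambda>s. F (apply_bcontfun g s) - F (apply_bcontfun h s)))"
        unfolding P_def dist_norm by (simp add: integral_diff[OF int int])
      also have "\<dots> \<le> L * dist g h * (c t - 0)"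
      proof (rule integral_bound)
        fix s
        have "norm (F (apply_bcontfun g s) - F (apply_bcontfun h s)) \<le> L * dist (apply_bcontfun g s) (apply_bcontfun h s)"
          using F_dist by (simp add: dist_norm)
        also have "\<dots> \<le> L * dist g h" using L0 by (intro mult_left_mono dist_bounded)
        finally show "norm (F (apply_bcontfun g s) - F (apply_bcontfun h s)) \<le> L * dist g h" .
      qed (use c in \<open>auto intro!: continuous_intros Fg_cont\<close>)
      also have "\<dots> \<le> L * dist g h * \<epsilon>"
        using c[of t] L0 by (intro mult_left_mono) auto
      also have "\<dots> = L * \<epsilon> * dist g h" by simp
      also have "\<dots> \<le> 1 / 2 * dist g h" using L\<epsilon> by (intro mult_right_mono) auto
      finally show "dist (apply_bcontfun (Bcontfun (P g)) t) (apply_bcontfun (Bcontfun (P h)) t) \<le> 1 / 2 * dist g h"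
        by (simp add: Bcontfun_inverse[OF P_in])
    qed
  qed auto
  then obtain g where "Bcontfun (P g) = g" by blast
  then have g: "apply_bcontfun g = P g" using Bcontfun_inverse[OF P_in] by metis
  show thesis
  proof (rule that[OF \<epsilon>, of "apply_bcontfun g"])
    show "apply_bcontfun g 0 = p" unfolding g using \<epsilon> by (simp add: P_def c_def)
  next
    fix t assume t: "t \<in> {0..\<epsilon>}"
    have ball: "apply_bcontfun g t \<in> cball p d"
      unfolding g using P_bound[of g t] c[of t] B\<epsilon> mult_left_mono[of "c t" \<epsilon> B] B0
      by (auto simp: dist_norm norm_minus_commute)
    have eq: "apply_bcontfun g s = p + integral {0..s} (\<lambda>s. F (apply_bcontfun g s))"
      if "s \<in> {0..\<epsilon>}" for s
    proof -
      have "c s = s" using that by (simp add: c_def)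
      then show ?thesis by (subst g) (simp add: P_def)
    qed
    have "((\<lambda>t. p + integral {0..t} (\<lambda>s. F (apply_bcontfun g s))) has_vector_derivative 0 + F (apply_bcontfun g t)) (at t within {0..\<epsilon>})"
      by (intro derivative_intros integral_has_vector_derivative[OF Fg_cont t])
    then have "(apply_bcontfun g has_vector_derivative F (apply_bcontfun g t)) (at t within {0..\<epsilon>})"
      unfolding add_0 by (rule has_vector_derivative_transform[OF t eq, rotated])
    moreover have "F (apply_bcontfun g t) = f (apply_bcontfun g t)"
      using ball by (simp add: F_def closest_point_self)
    ultimately show "apply_bcontfun g t \<in> cball p d \<and>
        (apply_bcontfun g has_vector_derivative f (apply_bcontfun g t)) (at t within {0..\<epsilon>})"
      using ball by simp
  qed
qed

text \<open>On a bounded set Lipschitz functions are bounded, so the splitting behind the product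
  rule gives a constant.\<close>

lemma lipschitz_on_mult_bounded:
  fixes f g :: "'a::heine_borel \<Rightarrow> real"
  assumes "bounded X" "L-lipschitz_on X f" "M-lipschitz_on X g"
  shows "\<exists>N. N-lipschitz_on X (\<lambda>x. f x * g x)"
proof -
  have "bounded (f ` X)" "bounded (g ` X)"
    using bounded_uniformly_continuous_image[OF lipschitz_on_uniformly_continuous[OF assms(2)] assms(1)]
      bounded_uniformly_continuous_image[OF lipschitz_on_uniformly_continuous[OF assms(3)] assms(1)] .
  then obtain a b where a: "\<And>x. x \<in> X \<Longrightarrow> \<bar>f x\<bar> \<le> a" and b: "\<And>x. x \<in> X \<Longrightarrow> \<bar>g x\<bar> \<le> b"
    unfolding bounded_iff by auto
  \<comment> \<open>For empty \<open>X\<close> the bounds \<open>a\<close> and \<open>b\<close> are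
    arbitrary, and a Lipschitz constant must not be negative.\<close>
  have "(max 0 (a * M + L * b))-lipschitz_on X (\<lambda>x. f x * g x)"
  proof (rule lipschitz_onI)
    fix x y assume xy: "x \<in> X" "y \<in> X"
    have "dist (f x * g x) (f y * g y) = \<bar>f x * (g x - g y) + (f x - f y) * g y\<bar>"
      by (simp add: dist_norm algebra_simps)
    also have "\<dots> \<le> \<bar>f x\<bar> * \<bar>g x - g y\<bar> + \<bar>f x - f y\<bar> * \<bar>g y\<bar>"
      by (metis abs_mult abs_triangle_ineq)
    also have "\<dots> \<le> a * (M * dist x y) + (L * dist x y) * b"
    proof (intro add_mono mult_mono)
      show "\<bar>f x\<bar> \<le> a" "\<bar>g y\<bar> \<le> b" using a b xy by auto
      show "0 \<le> a" using a[OF xy(1)] by linarith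
      show "\<bar>g x - g y\<bar> \<le> M * dist x y" "\<bar>f x - f y\<bar> \<le> L * dist x y"
        using lipschitz_onD[OF assms(2) xy] lipschitz_onD[OF assms(3) xy] by (auto simp: dist_norm)
      show "0 \<le> L * dist x y" using lipschitz_on_nonneg[OF assms(2)] by simp
    qed auto
    also have "\<dots> = (a * M + L * b) * dist x y" by (simp add: algebra_simps)
    also have "\<dots> \<le> max 0 (a * M + L * b) * dist x y" by (intro mult_right_mono) auto
    finally show "dist (f x * g x) (f y * g y) \<le> max 0 (a * M + L * b) * dist x y" .
  qed simp
  then show ?thesis by blast
qed

text \<open>The absolute value of the derivative decreases in \<open>s\<close>, so it is largest at
  the left endpoint \<open>m\<close>.\<close>

lemma lipschitz_on_powr:
  assumes "0 < m" "\<beta> \<ge> 0"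
  shows "\<exists>L. L-lipschitz_on {m..} (\<lambda>s::real. s powr (-\<beta>))"
proof -
  define L where "L = \<beta> * m powr (-\<beta> - 1)"
  have "L-lipschitz_on {m..} (\<lambda>s::real. s powr (-\<beta>))"
  proof (rule bounded_derivative_imp_lipschitz)
    fix s assume s: "s \<in> {m..}"
    show "((\<lambda>s. s powr (-\<beta>)) has_derivative (\<lambda>h. h * (-\<beta> * s powr (-\<beta> - 1)))) (at s within {m..})"
      using s assms(1) by (auto intro!: derivative_eq_intros simp: powr_diff)
    have "onorm (\<lambda>h. h * (-\<beta> * s powr (-\<beta> - 1))) \<le> L"
    proof (rule onorm_le)
      fix h :: real
      have "s powr (-\<beta> - 1) \<le> m powr (-\<beta> - 1)"
        using s assms by (intro powr_mono2') auto
      then show "norm (h * (-\<beta> * s powr (-\<beta> - 1))) \<le> L * norm h"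
        unfolding L_def using assms by (auto simp: abs_mult mult.commute intro!: mult_left_mono)
    qed
    then show "onorm (\<lambda>h. h * (-\<beta> * s powr (-\<beta> - 1))) \<le> L" .
  qed (use assms in \<open>auto simp: L_def\<close>)
  then show ?thesis by blast
qed

text \<open>A bounded derivative makes \<open>f\<close> Lipschitz, hence uniformly continuous, and
  completeness extends it to the missing endpoint.\<close>

lemma bounded_derivative_tendsto_at_left:
  fixes f :: "real \<Rightarrow> 'a::banach"
  assumes "a < b"
    and der: "\<And>t. t \<in> {a..<b} \<Longrightarrow> (f has_vector_derivative f' t) (at t within {a..<b})"
    and bound: "\<And>t. t \<in> {a..<b} \<Longrightarrow> norm (f' t) \<le> B"
  obtains l where "(f \<longlongrightarrow> l) (at_left b)"
proof -
  have "0 \<le> B" using order_trans[OF norm_ge_zero bound[of a]] assms(1) by simp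
  have "B-lipschitz_on {a..<b} f"
  proof (rule bounded_derivative_imp_lipschitz)
    show "(f has_derivative (\<lambda>h. h *\<^sub>R f' t)) (at t within {a..<b})" if "t \<in> {a..<b}" for t
      using der[OF that] by (simp add: has_vector_derivative_def)
    show "onorm (\<lambda>h. h *\<^sub>R f' t) \<le> B" if "t \<in> {a..<b}" for t
      using mult_right_mono[OF bound[OF that] abs_ge_zero] by (intro onorm_le) (simp add: mult.commute)
  qed (use \<open>0 \<le> B\<close> in auto)
  then have "uniformly_continuous_on {a..<b} f" by (rule lipschitz_on_uniformly_continuous)
  then obtain l where "(f \<longlongrightarrow> l) (at b within {a..<b})"
    using assms(1) by (auto elim: uniformly_continuous_on_extension_at_closure[of _ _ b])
  moreover have "at b within {a..<b} = at_left b"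
    using assms(1) by (intro at_within_nhd[of _ "{a<..}"]) auto
  ultimately show thesis using that by simp
qed

subsection \<open>Regularity of the Hill field and continuation of solutions\<close>

lemma sqrt_powr_eq:
  assumes "0 < (s::real)"
  shows "sqrt s powr \<beta> = s powr (\<beta> / 2)"
  using assms by (simp add: powr_powr flip: powr_half_sqrt)

text \<open>Free of \<open>deriv\<close> and of square roots, this form exhibits the field as built
  from coordinates and one power of the squared radius.\<close>

lemma hill_field_eq:
  assumes "(x, y) \<noteq> (0, 0)"
  shows "hill_field \<alpha> (x, y, u, v) =
    (u, v, 2 * v + (\<alpha> + 2) * x - \<alpha> * (\<alpha> + 2) * (x * (x\<^sup>2 + y\<^sup>2) powr (- ((\<alpha> + 2) / 2))),
     - 2 * u - \<alpha> * (\<alpha> + 2) * (y * (x\<^sup>2 + y\<^sup>2) powr (- ((\<alpha> + 2) / 2))))"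
proof -
  have s: "0 < x\<^sup>2 + y\<^sup>2" using assms by (simp add: sum_power2_gt_zero_iff)
  show ?thesis
    using DERIV_imp_deriv[OF DERIV_V_x[OF assms]] DERIV_imp_deriv[OF DERIV_V_y[OF assms]]
    by (simp add: Vx_def Vy_def sqrt_powr_eq[OF s] powr_minus_divide) (simp add: algebra_simps)
qed

lemma E_eq:
  assumes "(x, y, u, v) \<in> phase_space"
  shows "E \<alpha> (x, y, u, v) = (u\<^sup>2 + v\<^sup>2) / 2 - (\<alpha> + 2) / 2 * x\<^sup>2 - (\<alpha> + 2) * (x\<^sup>2 + y\<^sup>2) powr (- (\<alpha> / 2))"
proof -
  have "0 < x\<^sup>2 + y\<^sup>2" using assms by (simp add: sum_power2_gt_zero_iff phase_space_def)
  then show ?thesis by (simp add: V_def sqrt_powr_eq powr_minus_divide) (simp add: algebra_simps)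
qed

lemma W_eq':
  assumes "(x, y, u, v) \<in> phase_space"
  shows "W \<alpha> (x, y, u, v) = (\<alpha> + 2) * (x\<^sup>2 - \<alpha> * (x\<^sup>2 + y\<^sup>2) powr (- (\<alpha> / 2)))"
proof -
  have "0 < x\<^sup>2 + y\<^sup>2" using assms by (simp add: sum_power2_gt_zero_iff phase_space_def)
  then show ?thesis unfolding W_eq[OF assms] by (simp add: sqrt_powr_eq powr_minus_divide)
qed

text \<open>On a small ball the squared radius stays above half its value at \<open>p\<close>, and
  away from 0 its power is Lipschitz. The components then follow by sums and products of Lipschitz
  functions.\<close>

lemma hill_field_lipschitz_near:
  assumes "\<alpha> > 0" "p \<in> phase_space"
  obtains d L where "0 < d" "cball p d \<subseteq> phase_space" "L-lipschitz_on (cball p d) (hill_field \<alpha>)"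
proof -
  define s where "s z = fst z * fst z + fst (snd z) * fst (snd z)" for z :: state
  have s_pos: "0 < s z \<longleftrightarrow> z \<in> phase_space" for z
    by (cases z) (auto simp: s_def phase_space_def simp flip: power2_eq_square simp: sum_power2_gt_zero_iff)
  have "continuous_on UNIV s" unfolding s_def by (intro continuous_intros)
  then have "open (s -` {s p / 2 <..})" by (intro open_vimage) auto
  moreover have "p \<in> s -` {s p / 2 <..}" using s_pos assms(2) by auto
  ultimately obtain d where d: "0 < d" "cball p d \<subseteq> s -` {s p / 2 <..}"
    using open_contains_cball by metis
  let ?X = "cball p d"
  have sp: "0 < s p / 2" using s_pos assms(2) by auto
  have sub: "?X \<subseteq> phase_space" using d(2) sp by (auto simp flip: s_pos intro: less_trans)
  have proj: "1-lipschitz_on ?X fst" "1-lipschitz_on ?X (\<lambda>z. fst (snd z))"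
    "1-lipschitz_on ?X (\<lambda>z. fst (snd (snd z)))" "1-lipschitz_on ?X (\<lambda>z. snd (snd (snd z)))"
    by (rule lipschitz_onI; auto intro: order_trans[OF dist_fst_le] order_trans[OF dist_snd_le] dist_snd_le)+
  note mult = lipschitz_on_mult_bounded[OF bounded_cball]
  obtain L1 L2 where "L1-lipschitz_on ?X (\<lambda>z. fst z * fst z)"
    "L2-lipschitz_on ?X (\<lambda>z. fst (snd z) * fst (snd z))"
    using mult[OF proj(1) proj(1)] mult[OF proj(2) proj(2)] by blast
  then have s_lip: "(L1 + L2)-lipschitz_on ?X s" unfolding s_def by (rule lipschitz_on_add)
  obtain L3 where L3: "L3-lipschitz_on {s p / 2..} (\<lambda>r. r powr (- ((\<alpha> + 2) / 2)))"
    using lipschitz_on_powr[OF sp, of "(\<alpha> + 2) / 2"] assms(1) by auto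
  have "s ` ?X \<subseteq> {s p / 2..}" using d(2) by auto
  then have g: "(L3 * (L1 + L2))-lipschitz_on ?X (\<lambda>z. s z powr (- ((\<alpha> + 2) / 2)))"
    by (rule lipschitz_on_compose2[OF s_lip lipschitz_on_subset[OF L3]])
  obtain L4 L5 where "L4-lipschitz_on ?X (\<lambda>z. fst z * s z powr (- ((\<alpha> + 2) / 2)))"
    "L5-lipschitz_on ?X (\<lambda>z. fst (snd z) * s z powr (- ((\<alpha> + 2) / 2)))"
    using mult[OF proj(1) g] mult[OF proj(2) g] by blast
  note lip = lipschitz_on_Pair[OF proj(3) lipschitz_on_Pair[OF proj(4) lipschitz_on_Pair[OF
      lipschitz_on_diff[OF lipschitz_on_add[OF lipschitz_on_cmult_real[OF proj(4), of 2]
         lipschitz_on_cmult_real[OF proj(1), of "\<alpha> + 2"]] lipschitz_on_cmult_real[OF this(1), of "\<alpha> * (\<alpha> + 2)"]]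
      lipschitz_on_diff[OF lipschitz_on_cmult_real[OF proj(3), of "-2"] lipschitz_on_cmult_real[OF this(2), of "\<alpha> * (\<alpha> + 2)"]]]]]
  show thesis
  proof (rule that[OF d(1) sub], rule lipschitz_on_transform[OF lip])
    fix z assume "z \<in> ?X"
    then have "z \<in> phase_space" using sub by auto
    then show "hill_field \<alpha> z = (fst (snd (snd z)), snd (snd (snd z)),
          2 * snd (snd (snd z)) + (\<alpha> + 2) * fst z - \<alpha> * (\<alpha> + 2) * (fst z * s z powr (- ((\<alpha> + 2) / 2))),
          - 2 * fst (snd (snd z)) - \<alpha> * (\<alpha> + 2) * (fst (snd z) * s z powr (- ((\<alpha> + 2) / 2))))"
      by (cases z) (simp add: hill_field_eq phase_space_def s_def power2_eq_square del: hill_field.simps)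
  qed
qed

lemma hill_field_continuous:
  assumes "\<alpha> > 0"
  shows "continuous_on phase_space (hill_field \<alpha>)"
proof (rule continuous_at_imp_continuous_on, rule ballI)
  fix p assume "p \<in> phase_space"
  then obtain d L where "0 < d" "L-lipschitz_on (cball p d) (hill_field \<alpha>)"
    using hill_field_lipschitz_near[OF assms] by metis
  then show "isCont (hill_field \<alpha>) p"
    by (intro continuous_on_interior[OF lipschitz_on_continuous_on]) (auto simp: interior_cball)
qed

text \<open>In a compact set the velocity is bounded, so the solution has a limit at
  \<open>b\<close> inside the phase space. A local solution started at that limit continues it
  beyond \<open>b\<close>, against maximality.\<close>

lemma maximal_solution_leaves_compact:
  assumes \<alpha>: "\<alpha> > 0" and max: "maximal_solution \<alpha> (ereal b) \<gamma>"
    and a: "0 \<le> a" "a < b" and K: "compact K" "K \<subseteq> phase_space"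
  shows "\<exists>t\<in>{a..<b}. \<gamma> t \<notin> K"
proof (rule ccontr)
  assume "\<not> ?thesis"
  then have in_K: "\<gamma> t \<in> K" if "t \<in> {a..<b}" for t using that by auto
  have phase: "\<gamma> t \<in> phase_space"
    and der: "(\<gamma> has_vector_derivative hill_field \<alpha> (\<gamma> t)) (at t within {0..})"
    if "0 \<le> t" "t < b" for t
    using max that by (auto simp: maximal_solution_def solution_def)
  have der': "(\<gamma> has_vector_derivative hill_field \<alpha> (\<gamma> t)) (at t within {a..<b})"
    if "t \<in> {a..<b}" for t
    using that a by (intro has_vector_derivative_within_subset[OF der]) auto
  have "compact (hill_field \<alpha> ` K)"
    using K by (intro compact_continuous_image continuous_on_subset[OF hill_field_continuous[OF \<alpha>]])
  then obtain B where B: "\<And>z. z \<in> K \<Longrightarrow> norm (hill_field \<alpha> z) \<le> B"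
    by (meson bounded_iff compact_imp_bounded imageI)
  obtain l where l: "(\<gamma> \<longlongrightarrow> l) (at_left b)"
    using bounded_derivative_tendsto_at_left[OF a(2) der' B[OF in_K]] by blast
  have ev: "\<forall>\<^sub>F t in at_left b. t \<in> {a..<b}"
    using eventually_at_left_real[OF a(2)] by eventually_elim auto
  have "l \<in> K"
    using l ev in_K by (intro Lim_in_closed_set[OF compact_imp_closed[OF K(1)], of \<gamma> "at_left b"])
       (auto elim: eventually_mono)
  then have "l \<in> phase_space" using K by auto
  then obtain d L where d: "0 < d" "cball l d \<subseteq> phase_space" "L-lipschitz_on (cball l d) (hill_field \<alpha>)"
    using hill_field_lipschitz_near[OF \<alpha>] by metis
  obtain \<epsilon> \<eta> where \<epsilon>: "0 < \<epsilon>" and \<eta>0: "\<eta> 0 = l"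
    and \<eta>: "\<And>t. t \<in> {0..\<epsilon>} \<Longrightarrow> \<eta> t \<in> cball l d \<and>
      (\<eta> has_vector_derivative hill_field \<alpha> (\<eta> t)) (at t within {0..\<epsilon>})"
    using picard_local[OF d(1,3)] by metis
  define g where "g t = (if t < b then \<gamma> t else l)" for t
  have g_der: "(g has_vector_derivative hill_field \<alpha> (g t)) (at t within {0..})" if t: "0 \<le> t" "t < b" for t
  proof (rule has_vector_derivative_transform_within)
    show "(\<gamma> has_vector_derivative hill_field \<alpha> (g t)) (at t within {0..})"
      using der[OF t] t by (simp add: g_def)
    show "\<gamma> s = g s" if "dist s t < b - t" for s
      using that by (auto simp: g_def dist_real_def)
  qed (use t in auto)
  have g_cont: "continuous_on {a..b} g"
    unfolding continuous_on_def
  proof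
    fix t assume t: "t \<in> {a..b}"
    show "(g \<longlongrightarrow> g t) (at t within {a..b})"
    proof (cases "t = b")
      case True
      have "(g \<longlongrightarrow> l) (at_left b)"
        using l by (rule Lim_transform_eventually) (use ev in \<open>auto elim!: eventually_mono simp: g_def\<close>)
      then show ?thesis using True a by (simp add: g_def at_within_Icc_at_left)
    next
      case False
      then have "continuous (at t within {0..}) g"
        using t a by (intro has_vector_derivative_continuous[OF g_der]) auto
      then show ?thesis
        using a by (auto simp: continuous_within intro: tendsto_within_subset)
    qed
  qed
  have g_in: "g t \<in> phase_space" if "t \<in> {a..b}" for t
    using that phase[of t] \<open>l \<in> phase_space\<close> a by (auto simp: g_def)
  have f_cont: "continuous_on {a..b} (\<lambda>t. hill_field \<alpha> (g t))"
    using g_in by (intro continuous_on_compose2[OF hill_field_continuous[OF \<alpha>] g_cont]) auto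
  \<comment> \<open>Nothing is known yet about a derivative of \<open>g\<close> at \<open>b\<close>.
    The integral equation holds up to \<open>b\<close> by continuity, and differentiating it yields
    the one-sided derivative there.\<close>
  have g_eq: "g t = g a + integral {a..t} (\<lambda>t. hill_field \<alpha> (g t))" if t: "t \<in> {a..b}" for t
  proof -
    have "((\<lambda>t. hill_field \<alpha> (g t)) has_integral g t - g a) {a..t}"
    proof (rule fundamental_theorem_of_calculus_interior)
      show "continuous_on {a..t} g" using t by (intro continuous_on_subset[OF g_cont]) auto
      fix s assume "s \<in> {a<..<t}"
      then show "(g has_vector_derivative hill_field \<alpha> (g s)) (at s)"
        using g_der[of s] t a at_within_interior[of s "{0..}"] by auto
    qed (use t in auto)
    then show ?thesis by (simp add: integral_unique)
  qed
  have g_der': "(g has_vector_derivative hill_field \<alpha> (g t)) (at t within {a..b})" if t: "t \<in> {a..b}" for t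
  proof -
    have "((\<lambda>t. g a + integral {a..t} (\<lambda>t. hill_field \<alpha> (g t))) has_vector_derivative
        0 + hill_field \<alpha> (g t)) (at t within {a..b})"
      by (intro derivative_intros integral_has_vector_derivative[OF f_cont t])
    then show ?thesis
      unfolding add_0 by (rule has_vector_derivative_transform[OF t g_eq, rotated])
  qed
  have \<eta>_der: "((\<lambda>t. \<eta> (t - b)) has_vector_derivative hill_field \<alpha> (\<eta> (t - b))) (at t within {b..b + \<epsilon>})"
    if "t \<in> {b..b + \<epsilon>}" for t
  proof -
    have "((\<lambda>t. t - b) has_vector_derivative 1) (at t within {b..b + \<epsilon>})"
      by (auto intro!: derivative_eq_intros)
    moreover have "(\<eta> has_vector_derivative hill_field \<alpha> (\<eta> (t - b))) (at (t - b) within (\<lambda>t. t - b) ` {b..b + \<epsilon>})"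
      using \<eta>[of "t - b"] that by auto
    ultimately show ?thesis
      using vector_diff_chain_within[of "\<lambda>t. t - b" 1 t "{b..b + \<epsilon>}" \<eta>] by (simp add: o_def)
  qed
  define h where "h t = (if t < b then \<gamma> t else \<eta> (t - b))" for t
  \<comment> \<open>Both formulas give \<open>l\<close> at \<open>b\<close>, so the left piece may
    be taken on the closed interval. The one-sided derivatives at \<open>b\<close> then agree, both
    being the field at \<open>l\<close>.\<close>
  have h_eq: "h t = (if t \<in> {a..b} then g t else \<eta> (t - b))" if "t \<in> {a..b + \<epsilon>}" for t
    using that \<eta>0 by (auto simp: h_def g_def)
  have h_der: "(h has_vector_derivative hill_field \<alpha> (h t)) (at t within {a..b + \<epsilon>})" if t: "t \<in> {a..b + \<epsilon>}" for t
  proof -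
    have "((\<lambda>t. if t \<in> {a..b} then g t else \<eta> (t - b)) has_vector_derivative
        (if t \<in> {a..b} then hill_field \<alpha> (g t) else hill_field \<alpha> (\<eta> (t - b)))) (at t within {a..b + \<epsilon>})"
    proof (rule has_vector_derivative_If_within_closures[of _ _ "{b..b + \<epsilon>}"])
      have un: "{a..b} \<union> (closure {a..b} \<inter> closure {b..b + \<epsilon>}) = {a..b}"
        "{b..b + \<epsilon>} \<union> (closure {a..b} \<inter> closure {b..b + \<epsilon>}) = {b..b + \<epsilon>}"
        using a \<epsilon> by auto
      show "(g has_vector_derivative hill_field \<alpha> (g t)) (at t within {a..b} \<union> (closure {a..b} \<inter> closure {b..b + \<epsilon>}))"
        if "t \<in> {a..b} \<union> (closure {a..b} \<inter> closure {b..b + \<epsilon>})"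
        using that g_der' unfolding un by simp
      show "((\<lambda>t. \<eta> (t - b)) has_vector_derivative hill_field \<alpha> (\<eta> (t - b))) (at t within {b..b + \<epsilon>} \<union> (closure {a..b} \<inter> closure {b..b + \<epsilon>}))"
        if "t \<in> {b..b + \<epsilon>} \<union> (closure {a..b} \<inter> closure {b..b + \<epsilon>})"
        using that \<eta>_der unfolding un by simp
    qed (use t a \<epsilon> \<eta>0 in \<open>auto simp: g_def\<close>)
    then have "((\<lambda>t. if t \<in> {a..b} then g t else \<eta> (t - b)) has_vector_derivative hill_field \<alpha> (h t)) (at t within {a..b + \<epsilon>})"
      by (simp only: h_eq[OF t] if_distrib[of "hill_field \<alpha>"])
    then show ?thesis by (rule has_vector_derivative_transform[OF t h_eq, rotated])
  qed
  have "solution \<alpha> (ereal (b + \<epsilon>)) h"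
    unfolding solution_def
  proof (intro conjI allI impI; (elim conjE)?)
    show "0 < ereal (b + \<epsilon>)" using a \<epsilon> by simp
  next
    fix t assume t: "0 \<le> t" "ereal t < ereal (b + \<epsilon>)"
    show "h t \<in> phase_space" using phase[of t] t d(2) \<eta>[of "t - b"] by (auto simp: h_def)
    show "(h has_vector_derivative hill_field \<alpha> (h t)) (at t within {0..})"
    proof (cases "t < b")
      case True
      show ?thesis
      proof (rule has_vector_derivative_transform_within)
        show "(\<gamma> has_vector_derivative hill_field \<alpha> (h t)) (at t within {0..})"
          using der[of t] t True by (simp add: h_def)
        show "\<gamma> s = h s" if "dist s t < b - t" for s
          using that by (auto simp: h_def dist_real_def)
      qed (use t True in auto)
    next
      case False
      then have "at t within {a..b + \<epsilon>} = at t within {0..}"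
        using t a by (intro at_within_nhd[of _ "{a<..<b + \<epsilon>}"]) auto
      then show ?thesis using h_der[of t] False t a by auto
    qed
  qed
  moreover have "ereal b < ereal (b + \<epsilon>)" using \<epsilon> by simp
  moreover have "\<forall>t. 0 \<le> t \<and> ereal t < ereal b \<longrightarrow> h t = \<gamma> t" by (simp add: h_def)
  ultimately show False using max unfolding maximal_solution_def by blast
qed

subsection \<open>The virial inequality\<close>

text \<open>Bernoulli's inequality for real exponents: \<open>x powr k - k * x\<close> has
  derivative \<open>k * x powr (k - 1) - k\<close>, which is nonpositive up to
  \<open>x = 1\<close>.\<close>

lemma powr_ge_tangent_line:
  fixes p k :: real
  assumes "0 < p" "p \<le> 1" "1 \<le> k"
  shows "1 + k * (p - 1) \<le> p powr k"
proof -
  have "1 powr k - k * 1 \<le> p powr k - k * p"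
  proof (rule DERIV_nonpos_imp_nonincreasing[OF assms(2)])
    fix x assume x: "p \<le> x" "x \<le> 1"
    have "x powr (k - 1) \<le> 1" using x assms by (intro powr_le1) auto
    then have "k * x powr (k - 1) - k \<le> 0" using assms by (simp add: mult_left_le)
    moreover have "((\<lambda>x. x powr k - k * x) has_real_derivative k * x powr (k - 1) - k) (at x)"
      using x assms by (auto intro!: derivative_eq_intros)
    ultimately show "\<exists>y. ((\<lambda>x. x powr k - k * x) has_real_derivative y) (at x) \<and> y \<le> 0" by blast
  qed
  then show ?thesis by (simp add: algebra_simps)
qed

text \<open>
  Here \<open>s = r\<^sup>2\<close>, \<open>w = r powr (- \<alpha>)\<close>, \<open>\<sigma> = q\<^sup>2\<close>, \<open>\<omega> = q powr (- \<alpha>)\<close>, \<open>X = x\<^sup>2\<close>, \<open>K\<close> is the squared speed,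
  \<open>L\<close> the angular momentum and \<open>H\<close> the energy. The left-hand side is \<open>(r\<^sup>2 / 2)''\<close>; it increases in
  \<open>X\<close>, \<open>L\<close> and \<open>H\<close>, so the worst case is \<open>X = s\<close>, \<open>L\<^sup>2 = s * K\<close>, \<open>H = E\<^sup>*\<close>. In the variables
  \<open>a = w / \<omega> - 1\<close> and \<open>b = 1 - s / \<sigma>\<close> that case follows from Bernoulli's inequality.
\<close>

lemma virial_bound:
  fixes \<alpha> \<sigma> \<omega> s w X K L H :: real
  assumes \<alpha>: "2 \<le> \<alpha>" and \<sigma>: "\<sigma> = \<alpha> * \<omega>" "0 < \<omega>" "\<omega> = \<sigma> powr (- (\<alpha> / 2))"
    and s: "0 < s" "s \<le> \<sigma>" and w: "w = s powr (- (\<alpha> / 2))"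
    and X: "X \<le> s" and K: "K = 2 * H + (\<alpha> + 2) * X + 2 * (\<alpha> + 2) * w"
    and L: "L\<^sup>2 \<le> s * K" and H: "H \<le> - (\<alpha> + 2)\<^sup>2 * \<omega> / 2"
  shows "K + 2 * L + (\<alpha> + 2) * (X - \<alpha> * w) \<le> 2 * (H + (\<alpha> + 2)\<^sup>2 * \<omega> / 2)"
proof -
  define p a b where "p = s / \<sigma>" and "a = w / \<omega> - 1" and "b = 1 - p"
  have \<sigma>0: "0 < \<sigma>" unfolding \<sigma>(1) using \<sigma>(2) \<alpha> by simp
  have p: "0 < p" "p \<le> 1" using s \<sigma>0 by (auto simp: p_def)
  have s_eq: "s = \<alpha> * \<omega> * (1 - b)" using \<sigma>0 unfolding \<sigma>(1)[symmetric] by (simp add: p_def b_def)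
  have w_eq: "w = \<omega> * (1 + a)" using \<sigma>(2) by (simp add: a_def)
  have z: "w / \<omega> = p powr (- (\<alpha> / 2))"
    using s(1) \<sigma>0 by (subst w, subst \<sigma>(3)) (simp add: p_def powr_divide)
  have z1: "(1 + a) * p powr (\<alpha> / 2) = 1"
    using p(1) unfolding a_def z by (simp add: powr_minus)
  have a0: "0 \<le> a"
  proof -
    have "p powr (\<alpha> / 2) \<le> 1" using p \<alpha> by (intro powr_le1) auto
    then show ?thesis using p(1) unfolding a_def z by (simp add: powr_minus one_le_inverse)
  qed
  have b: "0 \<le> b" "b \<le> 1" using p by (auto simp: b_def)
  \<comment> \<open>This is where \<alpha> \<ge> 2 enters: it makes the exponent \<alpha>/2 at least
    1.\<close>
  have "1 + \<alpha> / 2 * (p - 1) \<le> p powr (\<alpha> / 2)" using p \<alpha> by (intro powr_ge_tangent_line) auto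
  then have "(1 + a) * (1 + \<alpha> / 2 * (p - 1)) \<le> (1 + a) * p powr (\<alpha> / 2)"
    using a0 by (intro mult_left_mono) auto
  then have tangent: "2 * a - \<alpha> * b \<le> \<alpha> * (a * b)"
    unfolding z1 by (simp add: b_def field_simps)
  \<comment> \<open>In units of \<open>(\<alpha> + 2) * \<omega>\<close>, \<open>m\<close> is the
    squared speed in the worst case and \<open>R\<close> is the bound on \<open>2 * L\<close> that
    the claim requires there.\<close>
  define m R where "m = 2 * a - \<alpha> * b" and "R = (\<alpha> - 2) * a + 2 * \<alpha> * b"
  have R0: "0 \<le> R" using \<alpha> a0 b by (simp add: R_def)
  \<comment> \<open>Up to a common factor this is the square of the required bound on
    \<open>2 * L\<close>, with \<open>s * K1\<close> in place of \<open>L\<^sup>2\<close>.\<close>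
  have key: "4 * \<alpha> * ((1 - b) * m) \<le> (\<alpha> + 2) * R\<^sup>2"
  proof -
    have "(1 - b) * m = 2 * a - \<alpha> * b - 2 * (a * b) + \<alpha> * b\<^sup>2"
      by (simp add: m_def algebra_simps power2_eq_square)
    also have "\<dots> \<le> (\<alpha> - 2) * (a * b) + \<alpha> * b\<^sup>2"
      using tangent by (simp add: algebra_simps)
    finally have "4 * \<alpha> * ((1 - b) * m) \<le> 4 * \<alpha> * ((\<alpha> - 2) * (a * b) + \<alpha> * b\<^sup>2)"
      using \<alpha> by (intro mult_left_mono) auto
    \<comment> \<open>The added term completes the square of \<open>R\<close>.\<close>
    also have "\<dots> \<le> ((\<alpha> - 2) * a)\<^sup>2 + \<dots>" by simp
    also have "\<dots> = R\<^sup>2" by (simp add: R_def power2_eq_square algebra_simps)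
    also have "\<dots> \<le> (\<alpha> + 2) * R\<^sup>2" using \<alpha> mult_right_mono[of 1 "\<alpha> + 2" "R\<^sup>2"] by simp
    finally show ?thesis .
  qed
  \<comment> \<open>The value of \<open>K\<close> in the worst case, where \<open>X = s\<close> and
    \<open>H\<close> is the ground state energy.\<close>
  define K1 where "K1 = (\<alpha> + 2) * \<omega> * m"
  have K1: "K1 = - (\<alpha> + 2)\<^sup>2 * \<omega> + (\<alpha> + 2) * s + 2 * (\<alpha> + 2) * w"
    unfolding K1_def m_def s_eq w_eq by (simp add: power2_eq_square algebra_simps)
  have "(\<alpha> + 2) * X \<le> (\<alpha> + 2) * s" using X \<alpha> by (intro mult_left_mono) auto
  then have "K \<le> K1" unfolding K K1 using H by simp
  then have "L\<^sup>2 \<le> s * K1" using L s(1) mult_left_mono[of K K1 s] by linarith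
  then have "(2 * L)\<^sup>2 \<le> 4 * (s * K1)" by (simp add: power_mult_distrib)
  also have "\<dots> = (\<alpha> + 2) * \<omega>\<^sup>2 * (4 * \<alpha> * ((1 - b) * m))"
    unfolding K1_def s_eq by (simp add: power2_eq_square algebra_simps)
  also have "\<dots> \<le> (\<alpha> + 2) * \<omega>\<^sup>2 * ((\<alpha> + 2) * R\<^sup>2)" using key \<alpha> by (intro mult_left_mono) auto
  also have "\<dots> = ((\<alpha> + 2) * \<omega> * R)\<^sup>2" by (simp add: power2_eq_square algebra_simps)
  finally have "(2 * L)\<^sup>2 \<le> ((\<alpha> + 2) * \<omega> * R)\<^sup>2" .
  moreover have "0 \<le> (\<alpha> + 2) * \<omega> * R" using R0 \<alpha> \<sigma>(2) by simp
  ultimately have "2 * L \<le> (\<alpha> + 2) * \<omega> * R" by (rule power2_le_imp_le)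
  also have "\<dots> = (\<alpha> + 2)\<^sup>2 * \<omega> - 2 * (\<alpha> + 2) * s + (\<alpha> - 2) * (\<alpha> + 2) * w"
    unfolding R_def s_eq w_eq by (simp add: power2_eq_square algebra_simps)
  also have "\<dots> \<le> (\<alpha> + 2)\<^sup>2 * \<omega> - 2 * ((\<alpha> + 2) * X) + (\<alpha> - 2) * (\<alpha> + 2) * w"
    using \<open>(\<alpha> + 2) * X \<le> (\<alpha> + 2) * s\<close> by linarith
  finally show ?thesis unfolding K by (simp add: algebra_simps)
qed

subsection \<open>Conserved energy and derivatives along a solution\<close>

locale hill_solution =
  fixes \<alpha> :: real and T :: ereal and \<gamma> :: "real \<Rightarrow> state"
  assumes \<alpha>: "\<alpha> > 0" and sol: "solution \<alpha> T \<gamma>"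
begin

text \<open>With \<open>r\<close> and \<open>q\<close> as above: \<open>s = r\<^sup>2\<close>, \<open>w = r powr (- \<alpha>)\<close>, \<open>\<sigma> = q\<^sup>2\<close>, \<open>\<omega> = q powr (- \<alpha>)\<close>.\<close>

definition x where "x t = fst (\<gamma> t)"
definition y where "y t = fst (snd (\<gamma> t))"
definition u where "u t = fst (snd (snd (\<gamma> t)))"
definition v where "v t = snd (snd (snd (\<gamma> t)))"
definition s where "s t = (x t)\<^sup>2 + (y t)\<^sup>2"
definition w where "w t = s t powr (- (\<alpha> / 2))"
text \<open>The factor \<open>r powr (- (\<alpha> + 2))\<close> of the attracting force, not the
  equilibrium radius that the text above calls \<open>q\<close>.\<close>

definition q where "q t = w t / s t"
definition J where "J t = x t * u t + y t * v t"
definition K where "K t = (u t)\<^sup>2 + (v t)\<^sup>2"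
definition \<sigma> where "\<sigma> = \<alpha> powr (2 / (\<alpha> + 2))"
definition \<omega> where "\<omega> = \<sigma> powr (- (\<alpha> / 2))"
definition dom where "dom t \<longleftrightarrow> 0 \<le> t \<and> ereal t < T"

lemma \<gamma>_eq: "\<gamma> t = (x t, y t, u t, v t)"
  by (simp add: x_def y_def u_def v_def)

lemma dom_mono: "dom t \<Longrightarrow> 0 \<le> t' \<Longrightarrow> t' \<le> t \<Longrightarrow> dom t'"
  by (auto simp: dom_def intro: le_less_trans[of "ereal t'" "ereal t"])

lemma dom_0: "dom 0"
  using sol by (simp add: dom_def solution_def flip: zero_ereal_def)

lemma \<sigma>_pos: "0 < \<sigma>" and \<omega>_pos: "0 < \<omega>"
  using \<alpha> by (auto simp: \<sigma>_def \<omega>_def)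

lemma \<omega>_eq: "\<omega> = \<alpha> powr (- \<alpha> / (\<alpha> + 2))"
proof -
  have "2 / (\<alpha> + 2) * - (\<alpha> / 2) = - \<alpha> / (\<alpha> + 2)" by (simp add: field_simps)
  then show ?thesis unfolding \<omega>_def \<sigma>_def powr_powr by (simp only:)
qed

lemma \<sigma>_eq: "\<sigma> = \<alpha> * \<omega>"
proof -
  have "2 / (\<alpha> + 2) = 1 + - \<alpha> / (\<alpha> + 2)" using \<alpha> by (simp add: field_simps)
  then show ?thesis unfolding \<sigma>_def \<omega>_eq using \<alpha> by (simp only: powr_add) simp
qed

lemma E_star_\<omega>: "E_star \<alpha> = - (\<alpha> + 2)\<^sup>2 * \<omega> / 2"
  unfolding E_star_eq(1)[OF \<alpha>] \<omega>_eq by simp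

context
  fixes t assumes dom: "dom t"
begin

lemma in_phase_space: "(x t, y t, u t, v t) \<in> phase_space"
  using sol dom by (auto simp: solution_def dom_def simp flip: \<gamma>_eq)

lemma s_pos: "0 < s t"
  using in_phase_space by (simp add: phase_space_def s_def sum_power2_gt_zero_iff)

lemma w_pos: "0 < w t"
  using s_pos by (simp add: w_def)

lemma x2_le_s: "(x t)\<^sup>2 \<le> s t"
  by (simp add: s_def)

lemma W_flow: "W \<alpha> (\<gamma> t) = (\<alpha> + 2) * ((x t)\<^sup>2 - \<alpha> * w t)"
  by (subst \<gamma>_eq, subst W_eq'[OF in_phase_space]) (simp only: w_def s_def)

lemma E_flow: "E \<alpha> (\<gamma> t) = K t / 2 - (\<alpha> + 2) / 2 * (x t)\<^sup>2 - (\<alpha> + 2) * w t"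
  by (subst \<gamma>_eq, subst E_eq[OF in_phase_space]) (simp only: w_def s_def K_def)

lemma deriv_components:
  "(x has_real_derivative u t) (at t within {0..})"
  "(y has_real_derivative v t) (at t within {0..})"
  "(u has_real_derivative 2 * v t + (\<alpha> + 2) * x t - \<alpha> * (\<alpha> + 2) * (x t * q t)) (at t within {0..})"
  "(v has_real_derivative - 2 * u t - \<alpha> * (\<alpha> + 2) * (y t * q t)) (at t within {0..})"
proof -
  have ws: "s t powr (- ((\<alpha> + 2) / 2)) = q t"
  proof -
    have "- ((\<alpha> + 2) / 2) = - (\<alpha> / 2) - 1" by (simp add: field_simps)
    then show ?thesis using s_pos by (simp only: powr_diff w_def q_def) simp
  qed
  have "(\<gamma> has_vector_derivative hill_field \<alpha> (\<gamma> t)) (at t within {0..})"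
    using sol dom by (auto simp: solution_def dom_def)
  moreover have "hill_field \<alpha> (\<gamma> t) = (u t, v t,
      2 * v t + (\<alpha> + 2) * x t - \<alpha> * (\<alpha> + 2) * (x t * q t),
      - 2 * u t - \<alpha> * (\<alpha> + 2) * (y t * q t))"
  proof -
    have ne: "(x t, y t) \<noteq> (0, 0)" using in_phase_space by (simp add: phase_space_def)
    show ?thesis
      by (subst \<gamma>_eq, subst hill_field_eq[OF ne], fold s_def, unfold ws, rule refl)
  qed
  ultimately have d: "(\<gamma> has_vector_derivative (u t, v t,
      2 * v t + (\<alpha> + 2) * x t - \<alpha> * (\<alpha> + 2) * (x t * q t),
      - 2 * u t - \<alpha> * (\<alpha> + 2) * (y t * q t))) (at t within {0..})" by simp
  note fst' = bounded_linear.has_vector_derivative[OF bounded_linear_fst]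
  note snd' = bounded_linear.has_vector_derivative[OF bounded_linear_snd]
  show "(x has_real_derivative u t) (at t within {0..})"
    "(y has_real_derivative v t) (at t within {0..})"
    "(u has_real_derivative 2 * v t + (\<alpha> + 2) * x t - \<alpha> * (\<alpha> + 2) * (x t * q t)) (at t within {0..})"
    "(v has_real_derivative - 2 * u t - \<alpha> * (\<alpha> + 2) * (y t * q t)) (at t within {0..})"
    using fst'[OF d] fst'[OF snd'[OF d]] fst'[OF snd'[OF snd'[OF d]]] snd'[OF snd'[OF snd'[OF d]]]
    unfolding has_real_derivative_iff_has_vector_derivative fst_conv snd_conv
      x_def[abs_def, symmetric] y_def[abs_def, symmetric] u_def[abs_def, symmetric] v_def[abs_def, symmetric]
    .
qed

lemma deriv_s: "(s has_real_derivative 2 * J t) (at t within {0..})"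
  unfolding s_def[abs_def]
  by (rule DERIV_cong[OF DERIV_add[OF DERIV_power[OF deriv_components(1), of 2] DERIV_power[OF deriv_components(2), of 2]]])
    (simp add: J_def algebra_simps)

lemma deriv_s_powr: "((\<lambda>t. s t powr \<beta>) has_real_derivative 2 * \<beta> * (s t powr \<beta> / s t) * J t) (at t within {0..})"
  by (rule DERIV_cong[OF DERIV_chain2[OF has_real_derivative_powr[OF s_pos] deriv_s]]) (use s_pos in \<open>simp add: powr_diff\<close>)

lemma deriv_w: "(w has_real_derivative - \<alpha> * q t * J t) (at t within {0..})"
  unfolding w_def[abs_def] q_def using deriv_s_powr[of "- (\<alpha> / 2)"] by (simp add: w_def)

text \<open>The Coriolis terms are orthogonal to the velocity and cancel.\<close>

lemma deriv_K: "(K has_real_derivative 2 * (\<alpha> + 2) * (x t * u t) - 2 * \<alpha> * (\<alpha> + 2) * q t * J t)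
  (at t within {0..})"
  unfolding K_def[abs_def]
  by (rule DERIV_cong[OF DERIV_add[OF DERIV_power[OF deriv_components(3), of 2] DERIV_power[OF deriv_components(4), of 2]]])
    (simp add: J_def algebra_simps)

lemma deriv_energy: "((\<lambda>t. K t / 2 - (\<alpha> + 2) / 2 * (x t)\<^sup>2 - (\<alpha> + 2) * w t) has_real_derivative 0) (at t within {0..})"
  by (rule DERIV_cong[OF DERIV_diff[OF DERIV_diff[OF DERIV_cdivide[OF deriv_K]
        DERIV_cmult[OF DERIV_power[OF deriv_components(1), of 2]]] DERIV_cmult[OF deriv_w]]])
     (simp add: field_simps)

text \<open>The virial identity: \<open>J\<close> is the derivative of \<open>r\<^sup>2 / 2\<close>,
  and the three summands are the squared speed, twice the angular momentum and
  \<open>W\<close>.\<close>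

lemma deriv_J: "(J has_real_derivative K t + 2 * (x t * v t - y t * u t) + (\<alpha> + 2) * ((x t)\<^sup>2 - \<alpha> * w t))
  (at t within {0..})"
proof -
  have w: "w t = ((x t)\<^sup>2 + (y t)\<^sup>2) * q t" using s_pos by (simp add: q_def flip: s_def)
  note d = DERIV_add[OF DERIV_mult[OF deriv_components(1,3)] DERIV_mult[OF deriv_components(2,4)]]
  show ?thesis
    unfolding J_def[abs_def]
    by (rule DERIV_cong[OF d], unfold w) (simp add: K_def power2_eq_square algebra_simps)
qed

end

lemma energy_constant:
  assumes "dom t"
  shows "E \<alpha> (\<gamma> t) = E \<alpha> (\<gamma> 0)"
proof -
  let ?H = "\<lambda>t. K t / 2 - (\<alpha> + 2) / 2 * (x t)\<^sup>2 - (\<alpha> + 2) * w t"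
  have "\<exists>c. \<forall>r\<in>{0..t}. ?H r = c"
  proof (rule has_derivative_zero_constant)
    fix r assume "r \<in> {0..t}"
    then have "(?H has_real_derivative 0) (at r within {0..t})"
      using dom_mono[OF assms, of r] by (intro DERIV_subset[OF deriv_energy]) auto
    then show "(?H has_derivative (\<lambda>h. 0)) (at r within {0..t})" unfolding has_field_derivative_def lambda_zero .
  qed simp
  moreover have "0 \<in> {0..t}" "t \<in> {0..t}" using assms by (auto simp: dom_def)
  ultimately have "?H t = ?H 0" by metis
  then show ?thesis by (simp add: E_flow assms dom_0)
qed

text \<open>Since \<sigma> = \<alpha> \<omega>, the quantities \<open>\<alpha> * w\<close> and
  \<open>s\<close> agree at \<open>s = \<sigma>\<close>. For smaller \<open>s\<close> the first
  exceeds the second, hence also \<open>x\<^sup>2\<close>.\<close>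

lemma \<sigma>_le_s:
  assumes "dom t" "\<alpha> * w t \<le> (x t)\<^sup>2"
  shows "\<sigma> \<le> s t"
proof (rule ccontr)
  assume "\<not> \<sigma> \<le> s t"
  then have lt: "s t < \<sigma>" by simp
  then have "\<omega> < w t"
    unfolding \<omega>_def w_def using s_pos[OF assms(1)] \<alpha> by (intro powr_less_mono2_neg) auto
  then have "\<sigma> < \<alpha> * w t" unfolding \<sigma>_eq using \<alpha> by simp
  then show False using assms(2) x2_le_s[OF assms(1)] lt by simp
qed

lemma w_le_\<omega>:
  assumes "dom t" "\<alpha> * w t \<le> (x t)\<^sup>2"
  shows "w t \<le> \<omega>"
  unfolding \<omega>_def w_def using \<sigma>_le_s[OF assms] \<sigma>_pos \<alpha> by (intro powr_mono2') auto

lemma norm_\<gamma>: "norm (\<gamma> t) = sqrt (s t + K t)"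
  by (subst \<gamma>_eq) (simp add: norm_Pair s_def K_def add.assoc)

lemma two_J_le: "2 * \<bar>J t\<bar> \<le> s t + K t"
proof -
  have "0 \<le> (x t - u t)\<^sup>2 + (y t - v t)\<^sup>2" "0 \<le> (x t + u t)\<^sup>2 + (y t + v t)\<^sup>2" by simp_all
  then have "2 * J t \<le> s t + K t" "- (2 * J t) \<le> s t + K t"
    by (simp_all add: s_def K_def J_def power2_eq_square algebra_simps)
  then show ?thesis by linarith
qed

lemma two_xu_le: "2 * (x t * u t) \<le> s t + K t"
proof -
  have "0 \<le> (x t - u t)\<^sup>2 + (y t)\<^sup>2 + (v t)\<^sup>2" by simp
  then show ?thesis by (simp add: s_def K_def power2_eq_square algebra_simps)
qed

text \<open>The form of the continuation criterion used for either sign of \<open>W\<close>. The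
  squared norm in phase space is \<open>s + K\<close>, so the two bounds describe a compact set that
  avoids the origin of configuration space.\<close>

lemma unconfined:
  assumes "maximal_solution \<alpha> T \<gamma>" and T: "T = ereal b" and "0 \<le> a" "a < b" "0 < m"
    and conf: "\<And>t. a \<le> t \<Longrightarrow> t < b \<Longrightarrow> m \<le> s t \<and> s t + K t \<le> M"
  shows False
proof -
  define C :: "state set" where
    "C = cball 0 (sqrt M) \<inter> (\<lambda>z. (fst z)\<^sup>2 + (fst (snd z))\<^sup>2) -` {m..}"
  have "compact C"
    unfolding C_def by (intro compact_Int_closed closed_vimage continuous_intros) auto
  moreover have "C \<subseteq> phase_space"
    using \<open>0 < m\<close> by (auto simp: C_def phase_space_def)
  ultimately obtain t where t: "t \<in> {a..<b}" "\<gamma> t \<notin> C"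
    using maximal_solution_leaves_compact[of \<alpha> b \<gamma> a C] \<alpha> assms by auto
  have "\<gamma> t \<in> C"
    using conf[of t] t by (auto simp: C_def norm_\<gamma> s_def x_def y_def)
  then show False using t by simp
qed

lemma continuous_on_initial:
  assumes "dom t" and "\<And>r. dom r \<Longrightarrow> (f has_real_derivative f' r) (at r within {0..})"
  shows "continuous_on {0..t} f"
proof (rule DERIV_continuous_on)
  fix r assume "r \<in> {0..t}"
  then show "(f has_real_derivative f' r) (at r within {0..t})"
    using dom_mono[OF assms(1)] by (intro DERIV_subset[OF assms(2)]) auto
qed

text \<open>Along the solution this function is \<open>W\<close> divided by \<alpha> + 2. Its
  continuity prepares the intermediate value argument on its sign.\<close>

lemma continuous_gap:
  assumes "dom t"
  shows "continuous_on {0..t} (\<lambda>r. (x r)\<^sup>2 - \<alpha> * w r)"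
  by (intro continuous_intros continuous_on_initial[OF assms deriv_components(1)]
      continuous_on_initial[OF assms deriv_w])

end

subsection \<open>Solutions below the ground state energy\<close>

locale below_ground = hill_solution +
  assumes below: "E \<alpha> (\<gamma> 0) < E_star \<alpha>"
begin

lemma K_eq:
  assumes "dom t"
  shows "K t = 2 * E \<alpha> (\<gamma> 0) + (\<alpha> + 2) * (x t)\<^sup>2 + 2 * (\<alpha> + 2) * w t"
  using E_flow[OF assms] energy_constant[OF assms] by (simp add: field_simps)

lemma K_nonneg: "0 \<le> K t"
  by (simp add: K_def)

text \<open>Kinetic energy is nonnegative. Inserting the energy bound and the hypothesis into
  \<open>K_eq\<close> leaves \<open>0 < (\<alpha> + 2)\<^sup>2 * (w t - \<omega>)\<close>.\<close>

lemma \<omega>_less_w: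
  assumes "dom t" "(x t)\<^sup>2 \<le> \<alpha> * w t"
  shows "\<omega> < w t"
proof -
  have "0 \<le> 2 * E \<alpha> (\<gamma> 0) + (\<alpha> + 2) * (x t)\<^sup>2 + 2 * (\<alpha> + 2) * w t"
    using K_eq[OF assms(1)] K_nonneg[of t] by simp
  also have "\<dots> < - (\<alpha> + 2)\<^sup>2 * \<omega> + (\<alpha> + 2) * (\<alpha> * w t) + 2 * (\<alpha> + 2) * w t"
    using below assms(2) \<alpha> mult_left_mono[OF assms(2), of "\<alpha> + 2"] unfolding E_star_\<omega> by linarith
  also have "\<dots> = (\<alpha> + 2)\<^sup>2 * (w t - \<omega>)" by (simp add: power2_eq_square algebra_simps)
  finally show ?thesis using \<alpha> by (simp add: zero_less_mult_iff)
qed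

text \<open>A zero would satisfy the hypotheses of both one-sided estimates and give \<omega> <
  \<open>w t\<close> \<le> \<omega>.\<close>

lemma gap_nonzero:
  assumes "dom t"
  shows "(x t)\<^sup>2 - \<alpha> * w t \<noteq> 0"
  using \<omega>_less_w[OF assms] w_le_\<omega>[OF assms] by auto

lemma gap_sign:
  assumes "dom t"
  shows "0 < (x t)\<^sup>2 - \<alpha> * w t \<longleftrightarrow> 0 < (x 0)\<^sup>2 - \<alpha> * w 0"
proof (rule ccontr)
  assume neq: "\<not> ?thesis"
  have t: "0 \<le> t" using assms by (simp add: dom_def)
  have "\<exists>r\<ge>0. r \<le> t \<and> (x r)\<^sup>2 - \<alpha> * w r = 0"
  proof (cases "0 < (x t)\<^sup>2 - \<alpha> * w t")
    case True
    then show ?thesis using neq t by (intro IVT' continuous_gap[OF assms]) auto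
  next
    case False
    then show ?thesis using neq t by (intro IVT2' continuous_gap[OF assms]) auto
  qed
  then show False using gap_nonzero dom_mono[OF assms] by blast
qed

text \<open>The radius stays away from 0, so only growth of the phase space norm could end the
  solution. Its square \<open>N\<close> satisfies \<open>N' \<le> c * N\<close>, which forbids
  blow-up in finite time.\<close>

lemma global_if_positive:
  assumes max: "maximal_solution \<alpha> T \<gamma>" and pos: "0 < (x 0)\<^sup>2 - \<alpha> * w 0"
  shows "T = \<infinity>"
proof (rule ccontr)
  assume "T \<noteq> \<infinity>"
  then obtain b where T: "T = ereal b" and b: "0 < b"
    using sol by (cases T) (auto simp: solution_def)
  have dom: "dom t" if "0 \<le> t" "t < b" for t using that T unfolding dom_def by simp
  \<comment> \<open>The constant is \<open>1 + 2 * (\<alpha> + 2)\<close>: the derivative of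
    \<open>s\<close> contributes at most \<open>N\<close>, that of \<open>K\<close> at most
    \<open>2 * (\<alpha> + 2) * N\<close>.\<close>
  define c N where "c = 2 * \<alpha> + 5" and "N t = s t + K t" for t
  have s: "\<sigma> \<le> s t" and q: "0 \<le> \<alpha> * q t" "\<alpha> * q t \<le> 1" if "0 \<le> t" "t < b" for t
  proof -
    have gap: "\<alpha> * w t \<le> (x t)\<^sup>2" using gap_sign[OF dom[OF that]] pos by simp
    then show "\<sigma> \<le> s t" using \<sigma>_le_s dom that by blast
    show "\<alpha> * q t \<le> 1" "0 \<le> \<alpha> * q t"
      using gap x2_le_s[OF dom[OF that]] s_pos[OF dom[OF that]] w_pos[OF dom[OF that]] \<alpha> by (auto simp: q_def)
  qed
  have N_bound: "N t \<le> N 0 * exp (c * b)" if t: "0 \<le> t" "t < b" for t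
  proof -
    \<comment> \<open>Gronwall's inequality by the integrating factor
      \<open>exp (- c * t)\<close>.\<close>
    have "N t * exp (- c * t) \<le> N 0 * exp (- c * 0)"
    proof (rule DERIV_nonpos_imp_decreasing_open[OF t(1)])
      fix r assume r: "0 < r" "r < t"
      have domr: "dom r" using dom r t by simp
      have at: "at r within {0..} = at r" using r by (intro at_within_interior) auto
      define D where "D = 2 * J r + (2 * (\<alpha> + 2) * (x r * u r) - 2 * \<alpha> * (\<alpha> + 2) * q r * J r)"
      have dN: "(N has_real_derivative D) (at r)"
        unfolding N_def[abs_def] D_def using DERIV_add[OF deriv_s[OF domr] deriv_K[OF domr]] by (simp add: at)
      have J: "2 * \<bar>J r\<bar> \<le> N r" and xu: "2 * (x r * u r) \<le> N r"
        unfolding N_def by (rule two_J_le two_xu_le)+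
      have q': "0 \<le> \<alpha> * q r" "\<alpha> * q r \<le> 1" using q[of r] r t by simp_all
      have "- ((\<alpha> * q r) * (2 * J r)) = \<alpha> * q r * - (2 * J r)" by (rule mult_minus_right[symmetric])
      also have "\<dots> \<le> \<alpha> * q r * (2 * \<bar>J r\<bar>)" by (rule mult_left_mono[OF _ q'(1)]) simp
      also have "\<dots> \<le> 1 * N r" by (rule mult_mono[OF q'(2) J]) simp_all
      finally have "- ((\<alpha> * q r) * (2 * J r)) \<le> N r" by simp
      then have "(\<alpha> + 2) * (2 * (x r * u r) - (\<alpha> * q r) * (2 * J r)) \<le> (\<alpha> + 2) * (2 * N r)"
        using xu \<alpha> by (intro mult_left_mono) auto
      then have "D \<le> c * N r"
        using J unfolding D_def c_def by (simp add: algebra_simps)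
      then have "(D - c * N r) * exp (- c * r) \<le> 0" by (intro mult_nonpos_nonneg) auto
      moreover have "((\<lambda>t. N t * exp (- c * t)) has_real_derivative (D - c * N r) * exp (- c * r)) (at r)"
        by (rule DERIV_cong[OF DERIV_mult[OF dN]])
           (auto intro!: derivative_eq_intros simp: algebra_simps)
      ultimately show "\<exists>d. ((\<lambda>t. N t * exp (- c * t)) has_real_derivative d) (at r) \<and> d \<le> 0" by blast
    next
      have "continuous_on {0..t} N" unfolding N_def[abs_def]
        by (intro continuous_intros continuous_on_initial[OF dom[OF t] deriv_s]
            continuous_on_initial[OF dom[OF t] deriv_K])
      then show "continuous_on {0..t} (\<lambda>t. N t * exp (- c * t))" by (intro continuous_intros)
    qed
    then have "N t \<le> N 0 * exp (c * t)" by (simp add: exp_minus field_simps)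
    also have "\<dots> \<le> N 0 * exp (c * b)"
      using t \<alpha> by (intro mult_left_mono) (auto simp: N_def s_def K_def c_def)
    finally show ?thesis .
  qed
  show False
    using unconfined[OF max T order_refl b \<sigma>_pos] s N_bound unfolding N_def by blast
qed

text \<open>The first three bounds confine the solution near the origin. The last one, obtained by
  dropping the negative energy, controls the speed by the singular potential alone.\<close>

lemma small_if_nonpositive:
  assumes "dom t" "(x 0)\<^sup>2 - \<alpha> * w 0 \<le> 0"
  shows "(x t)\<^sup>2 \<le> \<alpha> * w t" "\<omega> < w t" "s t < \<sigma>" "K t \<le> (\<alpha> + 2)\<^sup>2 * w t"
proof -
  show le: "(x t)\<^sup>2 \<le> \<alpha> * w t" using gap_sign[OF assms(1)] assms(2) by simp
  show less: "\<omega> < w t" using \<omega>_less_w[OF assms(1) le] .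
  show "s t < \<sigma>"
  proof (rule ccontr)
    assume "\<not> s t < \<sigma>"
    then have "w t \<le> \<omega>" unfolding \<omega>_def w_def using \<sigma>_pos \<alpha> by (intro powr_mono2') auto
    then show False using less by simp
  qed
  have "0 \<le> (\<alpha> + 2)\<^sup>2 * \<omega>" using \<omega>_pos by simp
  then have "K t \<le> (\<alpha> + 2) * (\<alpha> * w t) + 2 * (\<alpha> + 2) * w t"
    using K_eq[OF assms(1)] below mult_left_mono[OF le, of "\<alpha> + 2"] \<alpha> unfolding E_star_\<omega> by linarith
  also have "\<dots> = (\<alpha> + 2)\<^sup>2 * w t" by (simp add: power2_eq_square algebra_simps)
  finally show "K t \<le> (\<alpha> + 2)\<^sup>2 * w t" .
qed

lemma collides_if_finite:
  assumes max: "maximal_solution \<alpha> T \<gamma>" and nonpos: "(x 0)\<^sup>2 - \<alpha> * w 0 \<le> 0" and fin: "T \<noteq> \<infinity>"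
  shows "collides T \<gamma>"
proof -
  obtain b where T: "T = ereal b" and b: "0 < b"
    using sol fin by (cases T) (auto simp: solution_def)
  have dom: "dom t" if "t \<in> {0..<b}" for t using that T unfolding dom_def by simp
  note small = small_if_nonpositive[OF dom nonpos]
  \<comment> \<open>With this exponent \<open>P\<close> is \<open>r powr (\<alpha> + 2)\<close> and
    \<open>P / s = 1 / w\<close>. The derivative of \<open>P\<close> is thus
    \<open>2 * k * J / w\<close>, and \<open>J\<close> is at most of the order of
    \<open>w\<close>.\<close>
  define k where "k = \<alpha> / 2 + 1"
  have k: "0 < k" using \<alpha> by (simp add: k_def)
  define P where "P t = s t powr k" for t
  have sP: "s t = P t * w t" and P: "0 < P t" if "t \<in> {0..<b}" for t
    using s_pos[OF dom[OF that]] by (auto simp: P_def w_def k_def simp flip: powr_add)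
  have P_le: "P t \<le> \<alpha>" if "t \<in> {0..<b}" for t
  proof -
    have "P t * \<omega> \<le> P t * w t" using small(2)[OF that] P[OF that] by (intro mult_left_mono) auto
    also have "\<dots> \<le> \<alpha> * \<omega>" using small(3)[OF that] sP[OF that] \<sigma>_eq by simp
    finally show ?thesis using \<omega>_pos by simp
  qed
  have dP: "(P has_vector_derivative 2 * k * (P t / s t) * J t) (at t within {0..<b})" if "t \<in> {0..<b}" for t
    unfolding P_def[abs_def] has_real_derivative_iff_has_vector_derivative[symmetric]
    by (rule DERIV_subset[OF deriv_s_powr[OF dom[OF that]]]) auto
  have bound: "norm (2 * k * (P t / s t) * J t) \<le> k * (\<alpha> + (\<alpha> + 2)\<^sup>2)" if t: "t \<in> {0..<b}" for t
  proof -
    have w: "0 < w t" using w_pos dom t by blast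
    have "2 * \<bar>J t\<bar> \<le> s t + K t" by (rule two_J_le)
    also have "\<dots> \<le> \<alpha> * w t + (\<alpha> + 2)\<^sup>2 * w t"
      unfolding sP[OF t] using small(4)[OF t] P_le[OF t] w by (intro add_mono mult_right_mono) auto
    finally have "2 * \<bar>J t\<bar> / w t \<le> \<alpha> + (\<alpha> + 2)\<^sup>2" using w by (simp add: field_simps)
    then have "k * (2 * \<bar>J t\<bar> / w t) \<le> k * (\<alpha> + (\<alpha> + 2)\<^sup>2)" using k by (intro mult_left_mono) auto
    moreover have "P t / s t = 1 / w t" using sP[OF t] P[OF t] by simp
    ultimately show ?thesis using k w by (simp add: abs_mult mult.assoc mult.left_commute)
  qed
  obtain l where l: "(P \<longlongrightarrow> l) (at_left b)"
    using bounded_derivative_tendsto_at_left[OF b dP bound] by blast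
  have ev: "\<forall>\<^sub>F t in at_left b. t \<in> {0..<b}"
    using eventually_at_left_real[OF b] by eventually_elim auto
  have "l = 0"
  proof (rule ccontr)
    assume "l \<noteq> 0"
    moreover have "0 \<le> l"
      by (rule tendsto_lowerbound[OF l]) (auto simp: P_def)
    ultimately have l0: "0 < l" by simp
    then have "\<forall>\<^sub>F t in at_left b. l / 2 < P t" using l by (intro order_tendstoD) auto
    then obtain a' where a': "a' < b" "\<And>t. a' < t \<Longrightarrow> t < b \<Longrightarrow> l / 2 < P t"
      using b by (auto simp: eventually_at_left[OF b])
    \<comment> \<open>The midpoint lies strictly between \<open>a'\<close> and \<open>b\<close>; the
      maximum with 0 keeps the starting time nonnegative.\<close>
    define a where "a = max 0 ((a' + b) / 2)"
    have a: "0 \<le> a" "a < b" "a' < a" using a'(1) b by (auto simp: a_def less_max_iff_disj)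
    \<comment> \<open>From \<open>s = P * w\<close> and \<open>P \<ge> l / 2\<close>, the lower
      bound on \<open>w\<close> bounds \<open>s\<close> from below, while
      \<open>s < \<sigma>\<close> bounds \<open>w\<close>, and with it \<open>K\<close>, from
      above.\<close>
    have "l / 2 * \<omega> \<le> s t \<and> s t + K t \<le> \<sigma> + (\<alpha> + 2)\<^sup>2 * (\<sigma> / (l / 2))" if t: "a \<le> t" "t < b" for t
    proof
      have t': "t \<in> {0..<b}" using t a by simp
      have Pl: "l / 2 \<le> P t" using a'(2)[of t] t a by simp
      have "l / 2 * \<omega> \<le> P t * w t"
        using Pl small(2)[OF t'] \<omega>_pos P[OF t'] by (intro mult_mono) auto
      then show "l / 2 * \<omega> \<le> s t" using sP[OF t'] by simp
      have "w t * (l / 2) \<le> w t * P t" using Pl w_pos[OF dom[OF t']] by (intro mult_left_mono) auto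
      also have "\<dots> \<le> \<sigma>" using sP[OF t'] small(3)[OF t'] by (simp add: mult.commute)
      finally have "w t \<le> \<sigma> / (l / 2)" using l0 by (simp add: field_simps)
      then have "(\<alpha> + 2)\<^sup>2 * w t \<le> (\<alpha> + 2)\<^sup>2 * (\<sigma> / (l / 2))" by (intro mult_left_mono) auto
      then show "s t + K t \<le> \<sigma> + (\<alpha> + 2)\<^sup>2 * (\<sigma> / (l / 2))"
        using small(3,4)[OF t'] by linarith
    qed
    then show False
      using unconfined[OF max T a(1,2), of "l / 2 * \<omega>"] l0 \<omega>_pos by (meson half_gt_zero mult_pos_pos)
  qed
  then have "((\<lambda>t. P t powr (1 / k)) \<longlongrightarrow> 0) (at_left b)"
    using l k by (intro tendsto_zero_powrI[of P "at_left b" "\<lambda>_. 1 / k" "1 / k"]) (auto simp: P_def)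
  then have s0: "(s \<longlongrightarrow> 0) (at_left b)"
    by (rule Lim_transform_eventually)
       (use ev k in \<open>auto elim!: eventually_mono simp: P_def powr_powr s_def\<close>)
  have "((\<lambda>t. (x t, y t)) \<longlongrightarrow> (0, 0)) (at_left b)"
  proof (rule tendsto_norm_zero_cancel[of "\<lambda>t. (x t, y t)", unfolded zero_prod_def])
    show "((\<lambda>t. norm (x t, y t)) \<longlongrightarrow> 0) (at_left b)"
      using tendsto_real_sqrt[OF s0] by (simp add: norm_Pair s_def)
  qed
  moreover have "(\<lambda>t. position (\<gamma> t)) = (\<lambda>t. (x t, y t))"
    by (rule ext, subst \<gamma>_eq) simp
  ultimately show ?thesis by (simp add: collides_def T)
qed

lemma bounded_if_global:
  assumes "(x 0)\<^sup>2 - \<alpha> * w 0 \<le> 0" "T = \<infinity>"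
  shows "bounded ((\<lambda>t. position (\<gamma> t)) ` {0..})"
  unfolding bounded_iff
proof (intro exI ballI)
  fix z assume "z \<in> (\<lambda>t. position (\<gamma> t)) ` {0..}"
  then obtain t where t: "0 \<le> t" "z = position (\<gamma> t)" by auto
  have "position (\<gamma> t) = (x t, y t)" by (subst \<gamma>_eq) simp
  then have "norm z = sqrt (s t)" using t by (simp add: norm_Pair s_def)
  also have "\<dots> \<le> sqrt \<sigma>"
    using small_if_nonpositive(3)[of t, unfolded dom_def] assms t by simp
  finally show "norm z \<le> sqrt \<sigma>" .
qed

text \<open>The virial bound gives \<open>J' \<le> - c\<close> with a constant \<open>c > 0\<close>.
  Integrating twice puts \<open>s\<close> below a concave parabola, which eventually becomes
  negative.\<close>

lemma not_global:
  assumes nonpos: "(x 0)\<^sup>2 - \<alpha> * w 0 \<le> 0" and \<alpha>2: "2 \<le> \<alpha>"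
  shows "T \<noteq> \<infinity>"
proof
  assume "T = \<infinity>"
  then have dom: "dom t" if "0 \<le> t" for t using that unfolding dom_def by simp
  define c where "c = 2 * (E_star \<alpha> - E \<alpha> (\<gamma> 0))"
  have c: "0 < c" using below by (simp add: c_def)
  have at: "at r within {0..} = at r" if "0 < r" for r :: real
    using that by (intro at_within_interior) auto
  have dJ: "K t + 2 * (x t * v t - y t * u t) + (\<alpha> + 2) * ((x t)\<^sup>2 - \<alpha> * w t) \<le> - c" if t: "0 \<le> t" for t
  proof -
    have "K t + 2 * (x t * v t - y t * u t) + (\<alpha> + 2) * ((x t)\<^sup>2 - \<alpha> * w t)
        \<le> 2 * (E \<alpha> (\<gamma> 0) + (\<alpha> + 2)\<^sup>2 * \<omega> / 2)"
    proof (rule virial_bound[OF \<alpha>2 \<sigma>_eq \<omega>_pos \<omega>_def s_pos[OF dom[OF t]] _ w_def x2_le_s[OF dom[OF t]] K_eq[OF dom[OF t]]])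
      show "s t \<le> \<sigma>" using small_if_nonpositive(3)[OF dom[OF t] nonpos] by simp
      \<comment> \<open>Lagrange's identity for position and velocity.\<close>
      have "s t * K t - (x t * v t - y t * u t)\<^sup>2 = (J t)\<^sup>2"
        by (simp add: s_def K_def J_def power2_eq_square algebra_simps)
      then show "(x t * v t - y t * u t)\<^sup>2 \<le> s t * K t" using zero_le_power2[of "J t"] by linarith
      show "E \<alpha> (\<gamma> 0) \<le> - (\<alpha> + 2)\<^sup>2 * \<omega> / 2" using below E_star_\<omega> by simp
    qed
    then show ?thesis unfolding c_def E_star_\<omega> by simp
  qed
  have J_le: "J t \<le> J 0 - c * t" if t: "0 \<le> t" for t
  proof -
    have "J t + c * t \<le> J 0 + c * 0"
    proof (rule DERIV_nonpos_imp_decreasing_open[OF t])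
      fix r assume r: "0 < r" "r < t"
      have "((\<lambda>t. J t + c * t) has_real_derivative K r + 2 * (x r * v r - y r * u r) + (\<alpha> + 2) * ((x r)\<^sup>2 - \<alpha> * w r) + c) (at r)"
        using DERIV_add[OF deriv_J[OF dom, of r] DERIV_cmult[OF DERIV_ident, of c]] r by (simp add: at)
      moreover have "K r + 2 * (x r * v r - y r * u r) + (\<alpha> + 2) * ((x r)\<^sup>2 - \<alpha> * w r) + c \<le> 0"
        using dJ[of r] r by simp
      ultimately show "\<exists>d. ((\<lambda>t. J t + c * t) has_real_derivative d) (at r) \<and> d \<le> 0" by blast
    next
      have "continuous_on {0..t} J" by (rule continuous_on_initial[OF dom[OF t] deriv_J])
      then show "continuous_on {0..t} (\<lambda>t. J t + c * t)" by (intro continuous_intros)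
    qed
    then show ?thesis by simp
  qed
  have s_le: "s t \<le> s 0 + 2 * J 0 * t - c * t\<^sup>2" if t: "0 \<le> t" for t
  proof -
    have "s t - (2 * J 0 * t - c * t\<^sup>2) \<le> s 0 - (2 * J 0 * 0 - c * 0\<^sup>2)"
    proof (rule DERIV_nonpos_imp_decreasing_open[OF t])
      fix r assume r: "0 < r" "r < t"
      have "((\<lambda>t. s t - (2 * J 0 * t - c * t\<^sup>2)) has_real_derivative 2 * J r - (2 * J 0 - c * (2 * r))) (at r)"
        using deriv_s[OF dom, of r] r by (intro DERIV_diff) (auto intro!: derivative_eq_intros simp: at)
      moreover have "2 * J r - (2 * J 0 - c * (2 * r)) \<le> 0" using J_le[of r] r by simp
      ultimately show "\<exists>d. ((\<lambda>t. s t - (2 * J 0 * t - c * t\<^sup>2)) has_real_derivative d) (at r) \<and> d \<le> 0" by blast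
    next
      have "continuous_on {0..t} s" by (rule continuous_on_initial[OF dom[OF t] deriv_s])
      then show "continuous_on {0..t} (\<lambda>t. s t - (2 * J 0 * t - c * t\<^sup>2))" by (intro continuous_intros)
    qed
    then show ?thesis by simp
  qed
  \<comment> \<open>A time at which the parabola is no longer positive: \<open>t \<ge> 1\<close> and
    \<open>c * t \<ge> s 0 + 2 * \<bar>J 0\<bar>\<close> give
    \<open>c * t\<^sup>2 \<ge> s 0 + 2 * J 0 * t\<close>.\<close>
  define t where "t = (s 0 + 2 * \<bar>J 0\<bar>) / c + 1"
  have s0: "0 < s 0" using s_pos dom by blast
  have t1: "1 \<le> t" using c s0 by (simp add: t_def)
  have "c * t = s 0 + 2 * \<bar>J 0\<bar> + c" using c by (simp add: t_def field_simps)
  then have "c * t\<^sup>2 = (s 0 + 2 * \<bar>J 0\<bar> + c) * t" by (simp add: power2_eq_square)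
  also have "\<dots> = s 0 * t + 2 * \<bar>J 0\<bar> * t + c * t" by (simp add: algebra_simps)
  also have "\<dots> \<ge> s 0 + 2 * J 0 * t + 0"
    using t1 s0 c by (intro add_mono mult_right_mono) (auto simp: mult_le_cancel_left1)
  finally have "s t \<le> 0" using s_le[of t] t1 by simp
  then show False using s_pos[OF dom, of t] t1 by simp
qed

end

section \<open>From the sign along a single solution to the sets \<open>W_plus\<close> and
  \<open>W_minus\<close>\<close>

theorem theorem1:
  fixes \<alpha> :: real
  assumes "\<alpha> > 0"
  shows "invariant \<alpha> (W_plus \<alpha>) \<and>
    invariant \<alpha> (W_minus \<alpha>) \<and>
    (\<forall>T \<gamma>. maximal_solution \<alpha> T \<gamma> \<and> \<gamma> 0 \<in> W_plus \<alpha> \<longrightarrow> T = \<infinity>) \<and>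
    (\<forall>T \<gamma>. maximal_solution \<alpha> T \<gamma> \<and> \<gamma> 0 \<in> W_minus \<alpha> \<longrightarrow>
       (T = \<infinity> \<and> bounded ((\<lambda>t. position (\<gamma> t)) ` {0..})) \<or> collides T \<gamma>) \<and>
    (\<alpha> \<ge> 2 \<longrightarrow>
       (\<forall>T \<gamma>. maximal_solution \<alpha> T \<gamma> \<and> \<gamma> 0 \<in> W_minus \<alpha> \<longrightarrow> collides T \<gamma>))"
proof -
  have below: "below_ground \<alpha> T \<gamma>" if "solution \<alpha> T \<gamma>" "\<gamma> 0 \<in> W_plus \<alpha> \<union> W_minus \<alpha>" for T \<gamma>
    using that assms by unfold_locales (auto simp: W_plus_def W_minus_def)
  have max_sol: "solution \<alpha> T \<gamma>" if "maximal_solution \<alpha> T \<gamma>" for T \<gamma>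
    using that by (simp add: maximal_solution_def)
  have sign: "0 < W \<alpha> (\<gamma> t) \<longleftrightarrow> 0 < (hill_solution.x \<gamma> t)\<^sup>2 - \<alpha> * hill_solution.w \<alpha> \<gamma> t"
    if "solution \<alpha> T \<gamma>" "0 \<le> t" "ereal t < T" for T \<gamma> t
  proof -
    interpret hill_solution \<alpha> T \<gamma> using that assms by unfold_locales
    show ?thesis using that assms by (simp add: W_flow dom_def zero_less_mult_iff)
  qed
  \<comment> \<open>One equivalence settles both invariance claims, since below the ground state
    energy \<open>W_minus\<close> is the complement of \<open>W_plus\<close> in phase space.\<close>
  have inv: "E \<alpha> (\<gamma> t) < E_star \<alpha> \<and> \<gamma> t \<in> phase_space \<and> (0 < W \<alpha> (\<gamma> t) \<longleftrightarrow> 0 < W \<alpha> (\<gamma> 0))"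
    if s: "solution \<alpha> T \<gamma>" and W: "\<gamma> 0 \<in> W_plus \<alpha> \<union> W_minus \<alpha>" and t: "0 \<le> t" "ereal t < T" for T \<gamma> t
  proof -
    interpret below_ground \<alpha> T \<gamma> using below s W .
    have "dom t" using t by (simp add: dom_def)
    moreover have "ereal 0 < T" using s by (simp add: solution_def flip: zero_ereal_def)
    moreover have "\<gamma> t \<in> phase_space" using s t by (simp add: solution_def)
    ultimately show ?thesis
      using energy_constant[of t] below gap_sign[of t] sign[OF s t] sign[OF s, of 0] by simp
  qed
  have nonpos: "(hill_solution.x \<gamma> 0)\<^sup>2 - \<alpha> * hill_solution.w \<alpha> \<gamma> 0 \<le> 0"
    if "solution \<alpha> T \<gamma>" "\<gamma> 0 \<in> W_minus \<alpha>" for T \<gamma>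
    using sign[OF that(1), of 0] that by (auto simp: W_minus_def solution_def simp flip: zero_ereal_def)
  have plus: "T = \<infinity>" if max: "maximal_solution \<alpha> T \<gamma>" and W: "\<gamma> 0 \<in> W_plus \<alpha>" for T \<gamma>
  proof -
    interpret below_ground \<alpha> T \<gamma> using below max_sol[OF max] W by blast
    show ?thesis
      using global_if_positive[OF max] sign[OF max_sol[OF max], of 0] W max_sol[OF max]
      by (simp add: W_plus_def solution_def flip: zero_ereal_def)
  qed
  have minus: "(T = \<infinity> \<and> bounded ((\<lambda>t. position (\<gamma> t)) ` {0..})) \<or> collides T \<gamma>"
    and minus2: "\<alpha> \<ge> 2 \<Longrightarrow> collides T \<gamma>"
    if max: "maximal_solution \<alpha> T \<gamma>" and W: "\<gamma> 0 \<in> W_minus \<alpha>" for T \<gamma>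
  proof -
    interpret below_ground \<alpha> T \<gamma> using below max_sol[OF max] W by blast
    note np = nonpos[OF max_sol[OF max] W]
    show "(T = \<infinity> \<and> bounded ((\<lambda>t. position (\<gamma> t)) ` {0..})) \<or> collides T \<gamma>"
      using collides_if_finite[OF max np] bounded_if_global[OF np] by blast
    show "\<alpha> \<ge> 2 \<Longrightarrow> collides T \<gamma>"
      using collides_if_finite[OF max np] not_global[OF np] by blast
  qed
  show ?thesis
    using inv plus minus minus2 unfolding invariant_def W_plus_def W_minus_def
    by (auto simp: not_less[symmetric])
qed

end
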